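(* Let $(M,g)$ be an $m$-dimensional Riemannian manifold, let $(N,h)$ be a Riemannian manifold with constant sectional curvature $K\neq 0$, and let $\phi:(M,g)\to(N,h)$ be a biharmonic isometric immersion. Let $s\geq 2$ be an integer. If $\phi$ is $2s$-harmonic, then $\phi$ is harmonic.
   Context: All manifolds and maps are smooth. Let $\phi:(M,g)\to(N,h)$ be smooth, $m=\dim M$. Denote by $\nabla$, $\nabla^N$ the Levi-Civita connections of $M$, $N$, by $\overline\nabla$ the induced connection on the pull-back bundle $\phi^{-1}TN$, and by $\langle\cdot,\cdot\rangle$ the metric $h$. Let $\{e_i\}_{i=1}^m$ be a local orthonormal frame field on $M$. Tension field: $\tau(\phi)=\sum_{i=1}^m\big(\overline\nabla_{e_i}d\phi(e_i)-d\phi(\nabla_{e_i}e_i)\big)\in\Gamma(\phi^{-1}TN)$. The map $\phi$ is harmonic if $\tau(\phi)=0$. Rough Laplacian on sections of $\phi^{-1}TN$: $\overline\triangle=-\sum_{i=1}^m(\overline\nabla_{e_i}\overline\nabla_{e_i}-\overline\nabla_{\nabla_{e_i}e_i})$; $\overline\triangle^0$ is the identity. Curvature convention: $R^N(X,Y)=\nabla^N_X\nabla^N_Y-\nabla^N_Y\nabla^N_X-\nabla^N_{[X,Y]}$, so that for constant sectional curvature $K$ one has $R^N(X,Y)Z=K(\langle Y,Z\rangle X-\langle X,Z\rangle Y)$. The map $\phi$ is biharmonic (2-harmonic) if $\overline\triangle\tau(\phi)-\sum_{i=1}^m R^N(\tau(\phi),d\phi(e_i))d\phi(e_i)=0$.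 A $k$-harmonic map is a critical point of the $k$-energy $E_k(\phi)=\frac12\int_M\|(d+d^* )^k\phi\|^2v_g$. For $k=2s$ this is expressed by the Euler–Lagrange equation: $\phi$ is $2s$-harmonic if and only if $\tau_{2s}(\phi)=0$, where $$\tau_{2s}(\phi)=\overline\triangle^{2s-1}\tau(\phi)-\sum_{j=1}^m R^N(\overline\triangle^{2s-2}\tau(\phi),d\phi(e_j))d\phi(e_j)-\sum_{l=1}^{s-1}\sum_{j=1}^m\Big\{R^N(\overline\nabla_{e_j}\overline\triangle^{s+l-2}\tau(\phi),\overline\triangle^{s-l-1}\tau(\phi))d\phi(e_j)-R^N(\overline\triangle^{s+l-2}\tau(\phi),\overline\nabla_{e_j}\overline\triangle^{s-l-1}\tau(\phi))d\phi(e_j)\Big\}.$$ *)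

theory Defs
  imports "HOL-Analysis.Analysis"
begin

section \<open>Smooth maps between open subsets of Euclidean spaces\<close>

abbreviation deriv_at :: "('e::real_normed_vector \<Rightarrow> 'f::real_normed_vector) \<Rightarrow> 'e \<Rightarrow> 'e \<Rightarrow> 'f"
  where "deriv_at f x \<equiv> frechet_derivative f (at x)"

primrec Ck_on :: "nat \<Rightarrow> 'e::euclidean_space set \<Rightarrow> ('e \<Rightarrow> 'f::real_normed_vector) \<Rightarrow> bool"
  where
    "Ck_on 0 S f \<longleftrightarrow> continuous_on S f"
  | "Ck_on (Suc k) S f \<longleftrightarrow>
       (\<forall>x\<in>S. f differentiable at x) \<and> (\<forall>v. Ck_on k S (\<lambda>x. deriv_at f x v))"

definition smooth_on :: "'e::euclidean_space set \<Rightarrow> ('e \<Rightarrow> 'f::real_normed_vector) \<Rightarrow> bool"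
  where "smooth_on S f \<longleftrightarrow> open S \<and> (\<forall>k. Ck_on k S f)"


section \<open>Riemannian manifolds\<close>

text \<open>A chart is a pair of an open set and a coordinate map on it. A manifold is given by an atlas
  and its point set is the union of the chart domains; its dimension is \<open>DIM('e)\<close>. Tensor fields
  are represented by their components in charts; in particular \<open>metric M c x u v\<close> is the value of
  the metric at the point with \<open>c\<close>-coordinates \<open>x\<close> on the tangent vectors with
  \<open>c\<close>-components \<open>u\<close> and \<open>v\<close>.\<close>

type_synonym ('a, 'e) chart = "'a set \<times> ('a \<Rightarrow> 'e)"

type_synonym 'e metric_field = "'e \<Rightarrow> 'e \<Rightarrow> 'e \<Rightarrow> real"

record ('a, 'e) riemannian =
  charts :: "('a, 'e) chart set"
  metric :: "('a, 'e) chart \<Rightarrow> 'e metric_field"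

definition points :: "('a, 'e) riemannian \<Rightarrow> 'a set"
  where "points M = (\<Union>c\<in>charts M. fst c)"

definition chart_inv :: "('a, 'e) chart \<Rightarrow> 'e \<Rightarrow> 'a"
  where "chart_inv c = inv_into (fst c) (snd c)"

definition is_chart :: "('a::topological_space, 'e::euclidean_space) chart \<Rightarrow> bool"
  where "is_chart c \<longleftrightarrow> open (fst c) \<and> open (snd c ` fst c) \<and>
    homeomorphism (fst c) (snd c ` fst c) (snd c) (chart_inv c)"

definition transition :: "('a, 'e) chart \<Rightarrow> ('a, 'e) chart \<Rightarrow> 'e \<Rightarrow> 'e"
  where "transition c c' = snd c' \<circ> chart_inv c"

definition smooth_atlas :: "('a::topological_space, 'e::euclidean_space) chart set \<Rightarrow> bool"
  where "smooth_atlas A \<longleftrightarrow> (\<forall>c\<in>A. is_chart c) \<and>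
    (\<forall>c\<in>A. \<forall>c'\<in>A. smooth_on (snd c ` (fst c \<inter> fst c')) (transition c c'))"

definition riemannian_metric_on :: "'e::euclidean_space set \<Rightarrow> 'e metric_field \<Rightarrow> bool"
  where "riemannian_metric_on S G \<longleftrightarrow>
    (\<forall>x\<in>S. bilinear (G x) \<and> (\<forall>u v. G x u v = G x v u) \<and> (\<forall>u. u \<noteq> 0 \<longrightarrow> 0 < G x u u)) \<and>
    (\<forall>u v. smooth_on S (\<lambda>x. G x u v))"

definition riemannian_manifold ::
    "('a::{t2_space,second_countable_topology}, 'e::euclidean_space) riemannian \<Rightarrow> bool"
  where "riemannian_manifold M \<longleftrightarrow> smooth_atlas (charts M) \<and>
    (\<forall>c\<in>charts M. riemannian_metric_on (snd c ` fst c) (metric M c)) \<and>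
    (\<forall>c\<in>charts M. \<forall>c'\<in>charts M. \<forall>p \<in> fst c \<inter> fst c'. \<forall>u v.
      metric M c (snd c p) u v =
      metric M c' (snd c' p) (deriv_at (transition c c') (snd c p) u)
                             (deriv_at (transition c c') (snd c p) v))"


section \<open>Levi-Civita connection and curvature in a chart\<close>

text \<open>The Christoffel symbols, as a bilinear map \<open>\<Gamma>\<^sub>x(u, v)\<close>: Koszul's formula for vector fields
  \<open>u\<close>, \<open>v\<close>, \<open>z\<close> with constant components.\<close>

definition christoffel :: "'e::euclidean_space metric_field \<Rightarrow> 'e \<Rightarrow> 'e \<Rightarrow> 'e \<Rightarrow> 'e"
  where "christoffel G x u v = (THE w. \<forall>z. 2 * G x w z =
    deriv_at (\<lambda>y. G y v z) x u + deriv_at (\<lambda>y. G y u z) x v - deriv_at (\<lambda>y. G y u v) x z)"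

definition cov_deriv ::
    "'e::euclidean_space metric_field \<Rightarrow> ('e \<Rightarrow> 'e) \<Rightarrow> ('e \<Rightarrow> 'e) \<Rightarrow> 'e \<Rightarrow> 'e"
  where "cov_deriv G X Y x = deriv_at Y x (X x) + christoffel G x (X x) (Y x)"

definition lie_bracket ::
    "('e::euclidean_space \<Rightarrow> 'e) \<Rightarrow> ('e \<Rightarrow> 'e) \<Rightarrow> 'e \<Rightarrow> 'e"
  where "lie_bracket X Y x = deriv_at Y x (X x) - deriv_at X x (Y x)"

definition curvature_field :: "'e::euclidean_space metric_field \<Rightarrow>
    ('e \<Rightarrow> 'e) \<Rightarrow> ('e \<Rightarrow> 'e) \<Rightarrow> ('e \<Rightarrow> 'e) \<Rightarrow> 'e \<Rightarrow> 'e"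
  where "curvature_field G X Y Z x =
    cov_deriv G X (cov_deriv G Y Z) x - cov_deriv G Y (cov_deriv G X Z) x
    - cov_deriv G (lie_bracket X Y) Z x"

text \<open>The curvature is tensorial, so its value on vectors at \<open>x\<close> may be computed by extending them
  to vector fields with constant components.\<close>

definition curvature :: "'e::euclidean_space metric_field \<Rightarrow> 'e \<Rightarrow> 'e \<Rightarrow> 'e \<Rightarrow> 'e \<Rightarrow> 'e"
  where "curvature G x u v w = curvature_field G (\<lambda>_. u) (\<lambda>_. v) (\<lambda>_. w) x"

definition sectional_curvature :: "'e::euclidean_space metric_field \<Rightarrow> 'e \<Rightarrow> 'e \<Rightarrow> 'e \<Rightarrow> real"
  where "sectional_curvature G x u v =
    G x (curvature G x u v v) u / (G x u u * G x v v - (G x u v)\<^sup>2)"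

definition has_constant_sectional_curvature ::
    "('a, 'e::euclidean_space) riemannian \<Rightarrow> real \<Rightarrow> bool"
  where "has_constant_sectional_curvature M K \<longleftrightarrow>
    (\<forall>c\<in>charts M. \<forall>x \<in> snd c ` fst c. \<forall>u v. u \<noteq> v \<and> independent {u, v} \<longrightarrow>
      sectional_curvature (metric M c) x u v = K)"

text \<open>The connection defined by \<^const>\<open>christoffel\<close> is torsion-free and metric.\<close>

lemma riemannian_metric_onD:
  assumes "riemannian_metric_on S G" "x \<in> S"
  shows "bilinear (G x)" "G x u v = G x v u" "u \<noteq> 0 \<Longrightarrow> 0 < G x u u"
    "open S" "(\<lambda>y. G y u v) differentiable at x"
proof -
  have "Ck_on (Suc 0) S (\<lambda>y. G y u v)" "open S"
    using assms by (auto simp: riemannian_metric_on_def smooth_on_def simp del: Ck_on.simps)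
  then show "open S" "(\<lambda>y. G y u v) differentiable at x"
    using assms(2) by auto
qed (use assms in \<open>auto simp: riemannian_metric_on_def\<close>)

lemma deriv_at_metric_sym:
  assumes "riemannian_metric_on S G" "x \<in> S"
  shows "deriv_at (\<lambda>y. G y u v) x = deriv_at (\<lambda>y. G y v u) x"
  using riemannian_metric_onD[OF assms(1)] assms(2)
  by (intro frechet_derivative_transform_within_open[of _ _ S]) auto

lemma deriv_at_metric_linear:
  assumes "riemannian_metric_on S G" "x \<in> S"
  shows "linear (\<lambda>z. deriv_at (\<lambda>y. G y v z) x u)"
proof
  note D = riemannian_metric_onD[OF assms(1)]
  show "deriv_at (\<lambda>y. G y v (a + b)) x u = deriv_at (\<lambda>y. G y v a) x u + deriv_at (\<lambda>y. G y v b) x u"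
    for a b
  proof -
    have "deriv_at (\<lambda>y. G y v (a + b)) x = deriv_at (\<lambda>y. G y v a + G y v b) x"
      using D assms(2) by (intro frechet_derivative_transform_within_open[of _ _ S])
        (auto simp: bilinear_radd)
    also have "\<dots> = (\<lambda>h. deriv_at (\<lambda>y. G y v a) x h + deriv_at (\<lambda>y. G y v b) x h)"
      using D(5)[OF assms(2)]
      by (intro frechet_derivative_at[symmetric] has_derivative_add)
        (simp_all add: frechet_derivative_works)
    finally show ?thesis by simp
  qed
  show "deriv_at (\<lambda>y. G y v (r *\<^sub>R b)) x u = r *\<^sub>R deriv_at (\<lambda>y. G y v b) x u" for r b
  proof -
    have "((\<lambda>y. r * G y v b) has_derivative (\<lambda>h. r * deriv_at (\<lambda>y. G y v b) x h)) (at x)"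
      using D(5)[OF assms(2)]
      by (intro has_derivative_mult_right) (simp add: frechet_derivative_works)
    then have "((\<lambda>y. G y v (r *\<^sub>R b)) has_derivative (\<lambda>h. r * deriv_at (\<lambda>y. G y v b) x h)) (at x)"
      by (rule has_derivative_transform_within_open[OF _ D(4)[OF assms(2)] assms(2)])
        (use D(1) in \<open>auto simp: bilinear_rmul\<close>)
    then show ?thesis
      by (metis frechet_derivative_at real_scaleR_def)
  qed
qed

lemma koszul:
  assumes "riemannian_metric_on S G" "x \<in> S"
  shows "2 * G x (christoffel G x u v) z =
    deriv_at (\<lambda>y. G y v z) x u + deriv_at (\<lambda>y. G y u z) x v - deriv_at (\<lambda>y. G y u v) x z"
proof -
  note D = riemannian_metric_onD[OF assms]
  define F where "F z = deriv_at (\<lambda>y. G y v z) x u + deriv_at (\<lambda>y. G y u z) x v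
    - deriv_at (\<lambda>y. G y u v) x z" for z
  have F: "linear F"
    unfolding F_def
    by (intro linear_compose_add linear_compose_sub deriv_at_metric_linear[OF assms]
        linear_frechet_derivative D(5))
  define T where "T w = (\<Sum>b\<in>Basis. (2 * G x w b) *\<^sub>R b)" for w
  have lin: "linear (\<lambda>w. G x w b)" "linear (G x w)" for w b
    using D(1) by (auto simp: bilinear_def)
  have T: "linear T"
    by (rule linearI) (simp_all add: T_def linear_add[OF lin(1)] linear_cmul[OF lin(1)]
        algebra_simps sum.distrib scaleR_sum_right)
  have Tz: "T w \<bullet> z = 2 * G x w z" for w z
  proof -
    have "G x w z = G x w (\<Sum>b\<in>Basis. (z \<bullet> b) *\<^sub>R b)"
      by (simp add: euclidean_representation)
    also have "\<dots> = (\<Sum>b\<in>Basis. (z \<bullet> b) * G x w b)"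
      by (simp add: linear_sum[OF lin(2)] linear_cmul[OF lin(2)])
    finally have "2 * G x w z = 2 * (\<Sum>b\<in>Basis. (z \<bullet> b) * G x w b)"
      by simp
    also have "\<dots> = T w \<bullet> z"
      by (simp add: T_def inner_sum_left sum_distrib_left) (simp add: inner_commute ac_simps)
    finally show ?thesis ..
  qed
  have inj: "inj T"
  proof (subst linear_injective_0[OF T], safe)
    fix w assume "T w = 0"
    then show "w = 0"
      using Tz[of w w] D(3)[of w] by force
  qed
  then obtain w where w: "T w = (\<Sum>b\<in>Basis. F b *\<^sub>R b)"
    using linear_injective_imp_surjective[OF T] by (metis surj_def)
  have wz: "2 * G x w z = F z" for z
  proof -
    have "F z = F (\<Sum>b\<in>Basis. (z \<bullet> b) *\<^sub>R b)"
      by (simp add: euclidean_representation)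
    also have "\<dots> = T w \<bullet> z"
      by (simp add: w linear_sum[OF F] linear_cmul[OF F] inner_sum_left)
        (simp add: inner_commute mult.commute)
    finally show ?thesis
      by (simp add: Tz)
  qed
  have "\<forall>z. 2 * G x (christoffel G x u v) z = F z"
    unfolding christoffel_def F_def[symmetric]
  proof (rule theI[of _ w])
    show "w' = w" if "\<forall>z. 2 * G x w' z = F z" for w'
      using that wz inj Tz by (metis injD vector_eq_rdot)
  qed (use wz in auto)
  then show ?thesis
    by (simp add: F_def)
qed

lemma christoffel_torsion_free:
  assumes "riemannian_metric_on S G" "x \<in> S"
  shows "christoffel G x u v = christoffel G x v u"
  unfolding christoffel_def deriv_at_metric_sym[OF assms, of u v]
  by (subst add.commute) (rule refl)

lemma christoffel_metric:
  assumes "riemannian_metric_on S G" "x \<in> S"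
  shows "deriv_at (\<lambda>y. G y u v) x z = G x (christoffel G x z u) v + G x u (christoffel G x z v)"
  using koszul[OF assms, of z u v] koszul[OF assms, of z v u]
    riemannian_metric_onD(2)[OF assms, of u "christoffel G x z v"]
    fun_cong[OF deriv_at_metric_sym[OF assms, of u v], of z]
  by linarith


section \<open>Maps between Riemannian manifolds\<close>

definition overlap :: "('a, 'e) chart \<Rightarrow> ('b, 'f) chart \<Rightarrow> ('a \<Rightarrow> 'b) \<Rightarrow> 'e set"
  where "overlap c d \<phi> = snd c ` {p \<in> fst c. \<phi> p \<in> fst d}"

definition local_rep :: "('a, 'e) chart \<Rightarrow> ('b, 'f) chart \<Rightarrow> ('a \<Rightarrow> 'b) \<Rightarrow> 'e \<Rightarrow> 'f"
  where "local_rep c d \<phi> = snd d \<circ> \<phi> \<circ> chart_inv c"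

text \<open>As \<^const>\<open>smooth_on\<close> requires an open domain, the following implies continuity of \<open>\<phi>\<close>.\<close>

definition smooth_map :: "('a, 'e::euclidean_space) riemannian \<Rightarrow>
    ('b, 'f::euclidean_space) riemannian \<Rightarrow> ('a \<Rightarrow> 'b) \<Rightarrow> bool"
  where "smooth_map M N \<phi> \<longleftrightarrow> \<phi> ` points M \<subseteq> points N \<and>
    (\<forall>c\<in>charts M. \<forall>d\<in>charts N. smooth_on (overlap c d \<phi>) (local_rep c d \<phi>))"

definition isometric_immersion :: "('a, 'e::euclidean_space) riemannian \<Rightarrow>
    ('b, 'f::euclidean_space) riemannian \<Rightarrow> ('a \<Rightarrow> 'b) \<Rightarrow> bool"
  where "isometric_immersion M N \<phi> \<longleftrightarrow> smooth_map M N \<phi> \<and>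
    (\<forall>c\<in>charts M. \<forall>d\<in>charts N. \<forall>x \<in> overlap c d \<phi>.
      inj (deriv_at (local_rep c d \<phi>) x) \<and>
      (\<forall>u v. metric M c x u v =
        metric N d (local_rep c d \<phi> x) (deriv_at (local_rep c d \<phi>) x u)
                                       (deriv_at (local_rep c d \<phi>) x v)))"

text \<open>In what follows, \<open>G\<close> and \<open>H\<close> are the metrics of \<open>M\<close> and \<open>N\<close> in a chart of \<open>M\<close> and a chart of
  \<open>N\<close>, \<open>f\<close> represents the map in these charts, and sections of the pull-back bundle are functions
  \<open>V :: 'e \<Rightarrow> 'f\<close>. A local frame \<open>e\<close> is indexed by the \<open>DIM('e)\<close> elements of \<open>Basis\<close>.\<close>

definition orthonormal_frame_on ::
    "'e::euclidean_space metric_field \<Rightarrow> 'e set \<Rightarrow> ('e \<Rightarrow> 'e \<Rightarrow> 'e) \<Rightarrow> bool"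
  where "orthonormal_frame_on G W e \<longleftrightarrow> (\<forall>i\<in>Basis. smooth_on W (e i)) \<and>
    (\<forall>x\<in>W. \<forall>i\<in>Basis. \<forall>j\<in>Basis. G x (e i x) (e j x) = (if i = j then 1 else 0))"

definition push :: "('e::euclidean_space \<Rightarrow> 'f::euclidean_space) \<Rightarrow> ('e \<Rightarrow> 'e) \<Rightarrow> 'e \<Rightarrow> 'f"
  where "push f X x = deriv_at f x (X x)"

definition pullback_deriv :: "'f::euclidean_space metric_field \<Rightarrow>
    ('e::euclidean_space \<Rightarrow> 'f) \<Rightarrow> ('e \<Rightarrow> 'e) \<Rightarrow> ('e \<Rightarrow> 'f) \<Rightarrow> 'e \<Rightarrow> 'f"
  where "pullback_deriv H f X V x =
    deriv_at V x (X x) + christoffel H (f x) (push f X x) (V x)"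

definition tension :: "'e::euclidean_space metric_field \<Rightarrow> 'f::euclidean_space metric_field \<Rightarrow>
    ('e \<Rightarrow> 'f) \<Rightarrow> ('e \<Rightarrow> 'e \<Rightarrow> 'e) \<Rightarrow> 'e \<Rightarrow> 'f"
  where "tension G H f e x =
    (\<Sum>i\<in>Basis. pullback_deriv H f (e i) (push f (e i)) x - push f (cov_deriv G (e i) (e i)) x)"

definition rough_laplacian :: "'e::euclidean_space metric_field \<Rightarrow>
    'f::euclidean_space metric_field \<Rightarrow> ('e \<Rightarrow> 'f) \<Rightarrow> ('e \<Rightarrow> 'e \<Rightarrow> 'e) \<Rightarrow> ('e \<Rightarrow> 'f) \<Rightarrow> 'e \<Rightarrow> 'f"
  where "rough_laplacian G H f e V x =
    - (\<Sum>i\<in>Basis. pullback_deriv H f (e i) (pullback_deriv H f (e i) V) x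
        - pullback_deriv H f (cov_deriv G (e i) (e i)) V x)"

definition bitension :: "'e::euclidean_space metric_field \<Rightarrow> 'f::euclidean_space metric_field \<Rightarrow>
    ('e \<Rightarrow> 'f) \<Rightarrow> ('e \<Rightarrow> 'e \<Rightarrow> 'e) \<Rightarrow> 'e \<Rightarrow> 'f"
  where "bitension G H f e x = rough_laplacian G H f e (tension G H f e) x
    - (\<Sum>i\<in>Basis. curvature H (f x) (tension G H f e x) (push f (e i) x) (push f (e i) x))"

definition tau_even :: "nat \<Rightarrow> 'e::euclidean_space metric_field \<Rightarrow>
    'f::euclidean_space metric_field \<Rightarrow> ('e \<Rightarrow> 'f) \<Rightarrow> ('e \<Rightarrow> 'e \<Rightarrow> 'e) \<Rightarrow> 'e \<Rightarrow> 'f"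
  where "tau_even s G H f e x =
    (let D = (\<lambda>r. (rough_laplacian G H f e ^^ r) (tension G H f e));
         R = curvature H (f x);
         d = (\<lambda>j. push f (e j) x)
     in D (2 * s - 1) x
        - (\<Sum>j\<in>Basis. R (D (2 * s - 2) x) (d j) (d j))
        - (\<Sum>l = 1..s - 1. \<Sum>j\<in>Basis.
             R (pullback_deriv H f (e j) (D (s + l - 2)) x) (D (s - l - 1) x) (d j)
           - R (D (s + l - 2) x) (pullback_deriv H f (e j) (D (s - l - 1)) x) (d j)))"

text \<open>\<open>vanishes M N \<phi> T\<close>: the section of the pull-back bundle with local expression \<open>T\<close> is zero, in
  all charts and with respect to all local orthonormal frames. (The sections above do not depend on
  the choice of charts and frame.)\<close>

definition vanishes :: "('a, 'e::euclidean_space) riemannian \<Rightarrow>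
    ('b, 'f::euclidean_space) riemannian \<Rightarrow> ('a \<Rightarrow> 'b) \<Rightarrow>
    ('e metric_field \<Rightarrow> 'f metric_field \<Rightarrow> ('e \<Rightarrow> 'f) \<Rightarrow> ('e \<Rightarrow> 'e \<Rightarrow> 'e) \<Rightarrow> 'e \<Rightarrow> 'f) \<Rightarrow> bool"
  where "vanishes M N \<phi> T \<longleftrightarrow>
    (\<forall>c\<in>charts M. \<forall>d\<in>charts N. \<forall>W e. open W \<and> W \<subseteq> overlap c d \<phi> \<and>
      orthonormal_frame_on (metric M c) W e \<longrightarrow>
      (\<forall>x\<in>W. T (metric M c) (metric N d) (local_rep c d \<phi>) e x = 0))"

definition harmonic :: "('a, 'e::euclidean_space) riemannian \<Rightarrow>
    ('b, 'f::euclidean_space) riemannian \<Rightarrow> ('a \<Rightarrow> 'b) \<Rightarrow> bool"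
  where "harmonic M N \<phi> \<longleftrightarrow> smooth_map M N \<phi> \<and> vanishes M N \<phi> tension"

definition biharmonic :: "('a, 'e::euclidean_space) riemannian \<Rightarrow>
    ('b, 'f::euclidean_space) riemannian \<Rightarrow> ('a \<Rightarrow> 'b) \<Rightarrow> bool"
  where "biharmonic M N \<phi> \<longleftrightarrow> smooth_map M N \<phi> \<and> vanishes M N \<phi> bitension"

text \<open>\<open>2s\<close>-harmonicity, through the Euler--Lagrange equation of the \<open>2s\<close>-energy.\<close>

definition even_harmonic :: "nat \<Rightarrow> ('a, 'e::euclidean_space) riemannian \<Rightarrow>
    ('b, 'f::euclidean_space) riemannian \<Rightarrow> ('a \<Rightarrow> 'b) \<Rightarrow> bool"
  where "even_harmonic s M N \<phi> \<longleftrightarrow> smooth_map M N \<phi> \<and> vanishes M N \<phi> (tau_even s)"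

end

theory Submission
  imports Defs
begin

text \<open>
  Everything is pointwise. Let \<open>m\<close> be the dimension of the source and \<open>\<tau>\<close> the tension field. For an
  isometric immersion \<open>\<tau>\<close> is the trace of the second fundamental form, hence normal to the immersion
  (\<open>second_form_normal\<close>, \<open>tension_normal\<close>). In a space of constant curvature \<open>K\<close> one has
  \<open>R(u, v)w = K(\<langle>v, w\<rangle>u - \<langle>u, w\<rangle>v)\<close> (\<open>curvature_constant\<close>), so for normal \<open>\<tau>\<close> the curvature term of
  the bitension field is \<open>mK\<tau>\<close>, and biharmonicity says that \<open>\<tau>\<close> is an eigensection of the rough
  Laplacian, \<open>\<Delta>\<tau> = mK\<tau>\<close>. Thus \<open>\<Delta>\<^sup>r\<tau> = (mK)\<^sup>r\<tau>\<close>.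

  Inserting this in \<open>\<tau>\<^bsub>2s\<^esub>\<close>, the two leading terms cancel, and each of the \<open>s - 1\<close> remaining summands equals
  \<open>-2K(mK)\<^bsup>2s-3\<^esup> (\<Sum>\<^sub>j \<langle>\<nabla>\<^sub>j\<tau>, d\<phi>(e\<^sub>j)\<rangle>) \<tau>\<close>. Differentiating \<open>\<langle>\<tau>, d\<phi>(e\<^sub>j)\<rangle> = 0\<close> shows that the sum in
  brackets is \<open>-\<bar>\<tau>\<bar>\<^sup>2\<close> (\<open>tension_divergence\<close>). Hence
  \<open>\<tau>\<^bsub>2s\<^esub> = -2(s - 1)K(mK)\<^bsup>2s-3\<^esup> \<bar>\<tau>\<bar>\<^sup>2 \<tau>\<close> (\<open>tau_even_biharmonic\<close>), and \<open>K \<noteq> 0\<close> and \<open>s \<ge> 2\<close> force \<open>\<tau> = 0\<close>.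

  Since derivatives are meaningful only where they exist, the sections involved must be shown to be
  smooth. The one nontrivial point is the smoothness of the Christoffel symbols, which are given only
  implicitly by their metric pairings; they are expanded in an orthogonal frame obtained by the
  Gram--Schmidt process (\<open>orthogonal_field_exists\<close>, \<open>christoffel_smooth\<close>).
\<close>

section \<open>Calculus of smooth maps\<close>

lemma Ck_on_cong:
  assumes "open S" "\<And>x. x \<in> S \<Longrightarrow> f x = g x"
  shows "Ck_on k S f \<longleftrightarrow> Ck_on k S g"
  using assms(2)
proof (induction k arbitrary: f g)
  case 0
  then show ?case by (simp cong: continuous_on_cong)
next
  case (Suc k)
  have d: "deriv_at f x = deriv_at g x" if "x \<in> S" "f differentiable at x" for x
    using frechet_derivative_transform_within_open[OF that(2) assms(1) that(1)] Suc.prems by auto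
  have diff: "f differentiable at x \<longleftrightarrow> g differentiable at x" if "x \<in> S" for x
    unfolding differentiable_def
    using has_derivative_transform_within_open[OF _ assms(1) that] Suc.prems by metis
  show ?case
    using Suc.IH[of "\<lambda>x. deriv_at f x v" "\<lambda>x. deriv_at g x v" for v] d diff by auto
qed

lemma Ck_on_SucI:
  assumes "open S" "\<And>x. x \<in> S \<Longrightarrow> (f has_derivative f' x) (at x)" "\<And>v. Ck_on k S (\<lambda>x. f' x v)"
  shows "Ck_on (Suc k) S f"
proof -
  have "deriv_at f x = f' x" if "x \<in> S" for x
    using frechet_derivative_at[OF assms(2)[OF that]] by simp
  then have "Ck_on k S (\<lambda>x. deriv_at f x v)" for v
    using Ck_on_cong[OF assms(1), of "\<lambda>x. deriv_at f x v" "\<lambda>x. f' x v" k] assms(3) by simp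
  then show ?thesis
    using assms(2) by (auto simp: differentiable_def)
qed

lemma Ck_on_SucD:
  assumes "Ck_on (Suc k) S f"
  shows "x \<in> S \<Longrightarrow> (f has_derivative deriv_at f x) (at x)" "Ck_on k S (\<lambda>x. deriv_at f x v)"
  using assms by (auto simp: frechet_derivative_works)

lemma Ck_on_Suc_imp: "Ck_on (Suc k) S f \<Longrightarrow> Ck_on k S f"
proof (induction k arbitrary: f)
  case 0
  then show ?case
    by (auto intro!: continuous_at_imp_continuous_on differentiable_imp_continuous_within)
next
  case (Suc k)
  then have "\<forall>x\<in>S. f differentiable at x" "\<And>v. Ck_on (Suc k) S (\<lambda>x. deriv_at f x v)"
    unfolding Ck_on.simps(2)[of "Suc k"] by blast+
  then show ?case
    using Suc.IH by simp
qed

lemma Ck_on_const: "open S \<Longrightarrow> Ck_on k S (\<lambda>x. c)"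
  by (induction k arbitrary: c) (auto intro!: Ck_on_SucI[where f' = "\<lambda>_ _. 0"] simp del: Ck_on.simps(2))

lemma Ck_on_ident: "open S \<Longrightarrow> Ck_on k S (\<lambda>x. x)"
  by (cases k) (auto intro!: Ck_on_SucI[where f' = "\<lambda>_ v. v"] Ck_on_const simp del: Ck_on.simps(2))

lemma Ck_on_add:
  assumes "open S"
  shows "Ck_on k S f \<Longrightarrow> Ck_on k S g \<Longrightarrow> Ck_on k S (\<lambda>x. f x + g x)"
proof (induction k arbitrary: f g)
  case (Suc k)
  show ?case
    using Suc.prems[THEN Ck_on_SucD(1)] Suc.prems[THEN Ck_on_SucD(2)]
    by (intro Ck_on_SucI[OF assms, where f' = "\<lambda>x v. deriv_at f x v + deriv_at g x v"]
        has_derivative_add Suc.IH)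
qed (auto intro: continuous_intros)

lemma Ck_on_sum:
  assumes "open S"
  shows "(\<And>i. i \<in> I \<Longrightarrow> Ck_on k S (f i)) \<Longrightarrow> Ck_on k S (\<lambda>x. \<Sum>i\<in>I. f i x)"
  by (induction I rule: infinite_finite_induct) (auto intro: Ck_on_add Ck_on_const assms)

lemma (in bounded_bilinear) Ck_on:
  assumes "open S"
  shows "Ck_on k S f \<Longrightarrow> Ck_on k S g \<Longrightarrow> Ck_on k S (\<lambda>x. prod (f x) (g x))"
proof (induction k arbitrary: f g)
  case (Suc k)
  show ?case
    using Suc.prems[THEN Ck_on_SucD(1)] Suc.prems[THEN Ck_on_SucD(2)] Suc.prems[THEN Ck_on_Suc_imp]
    by (intro Ck_on_SucI[OF assms, where
          f' = "\<lambda>x v. prod (f x) (deriv_at g x v) + prod (deriv_at f x v) (g x)"]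
        FDERIV Ck_on_add[OF assms] Suc.IH)
qed (auto intro: continuous_on)

lemma Ck_on_inverse:
  fixes g :: "'e::euclidean_space \<Rightarrow> real"
  assumes "open S" "\<And>x. x \<in> S \<Longrightarrow> g x \<noteq> 0"
  shows "Ck_on k S g \<Longrightarrow> Ck_on k S (\<lambda>x. inverse (g x))"
proof (induction k)
  case 0
  then show ?case using assms by (auto intro: continuous_intros)
next
  case (Suc k)
  have i: "Ck_on k S (\<lambda>x. inverse (g x))"
    using Suc Ck_on_Suc_imp by blast
  show ?case
  proof (rule Ck_on_SucI[OF assms(1)])
    show "((\<lambda>x. inverse (g x)) has_derivative
        (\<lambda>v. (- 1) * (inverse (g x) * deriv_at g x v * inverse (g x)))) (at x)" if "x \<in> S" for x
      using Deriv.has_derivative_inverse[OF assms(2)[OF that] Ck_on_SucD(1)[OF Suc.prems that]] by simp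
    show "Ck_on k S (\<lambda>x. (- 1) * (inverse (g x) * deriv_at g x v * inverse (g x)))" for v
      using i Ck_on_SucD(2)[OF Suc.prems]
      by (intro bounded_bilinear.Ck_on[OF bounded_bilinear_mult assms(1)] Ck_on_const[OF assms(1)])
  qed
qed

lemma linear_expand_Basis:
  fixes L :: "'e::euclidean_space \<Rightarrow> 'f::real_vector"
  assumes "linear L"
  shows "L v = (\<Sum>b\<in>Basis. (v \<bullet> b) *\<^sub>R L b)"
  by (metis (no_types, lifting) assms euclidean_representation linear_cmul linear_sum sum.cong)

lemma Ck_on_compose:
  fixes g :: "'e::euclidean_space \<Rightarrow> 'u::euclidean_space"
  assumes "open S" "g ` S \<subseteq> T"
  shows "Ck_on k T f \<Longrightarrow> Ck_on k S g \<Longrightarrow> Ck_on k S (\<lambda>x. f (g x))"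
proof (induction k arbitrary: f)
  case 0
  then show ?case using assms continuous_on_compose2[of T f S g] by simp
next
  case (Suc k)
  have f: "(f has_derivative deriv_at f (g x)) (at (g x))" if "x \<in> S" for x
    using Suc.prems(1)[THEN Ck_on_SucD(1)] assms(2) that by blast
  have g: "(g has_derivative deriv_at g x) (at x)" if "x \<in> S" for x
    using Suc.prems(2)[THEN Ck_on_SucD(1)] that by blast
  show ?case
  proof (rule Ck_on_SucI[OF assms(1)])
    show "((\<lambda>x. f (g x)) has_derivative
       (\<lambda>v. \<Sum>b\<in>Basis. (deriv_at g x v \<bullet> b) *\<^sub>R deriv_at f (g x) b)) (at x)" if "x \<in> S" for x
      unfolding linear_expand_Basis[OF has_derivative_linear[OF f[OF that]], symmetric]
      by (rule has_derivative_compose[OF g[OF that] f[OF that]])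
    show "Ck_on k S (\<lambda>x. \<Sum>b\<in>Basis. (deriv_at g x v \<bullet> b) *\<^sub>R deriv_at f (g x) b)" for v
      by (intro Ck_on_sum bounded_bilinear.Ck_on[OF bounded_bilinear_scaleR]
          bounded_bilinear.Ck_on[OF bounded_bilinear_inner] Ck_on_const assms Suc.IH
          Suc.prems[THEN Ck_on_SucD(2)] Suc.prems(2)[THEN Ck_on_Suc_imp])
  qed
qed

lemma smooth_onD:
  assumes "smooth_on S f"
  shows "open S" "x \<in> S \<Longrightarrow> f differentiable at x"
    "x \<in> S \<Longrightarrow> (f has_derivative deriv_at f x) (at x)"
    "smooth_on S (\<lambda>x. deriv_at f x v)"
proof -
  have "open S" "Ck_on (Suc k) S f" for k
    using assms unfolding smooth_on_def by blast+
  note Ck_on.simps(2)[THEN iffD1, OF this(2)]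
  with \<open>open S\<close> show "open S" "x \<in> S \<Longrightarrow> f differentiable at x"
    "x \<in> S \<Longrightarrow> (f has_derivative deriv_at f x) (at x)"
    "smooth_on S (\<lambda>x. deriv_at f x v)"
    by (auto simp: smooth_on_def frechet_derivative_works)
qed

lemma smooth_on_cong:
  assumes "\<And>x. x \<in> S \<Longrightarrow> f x = g x"
  shows "smooth_on S f \<longleftrightarrow> smooth_on S g"
  using Ck_on_cong[of S f g] assms by (auto simp: smooth_on_def)

lemma smooth_on_subset:
  assumes "smooth_on S f" "open T" "T \<subseteq> S"
  shows "smooth_on T f"
proof -
  have "Ck_on k T g" if "Ck_on k S g" for k and g :: "'a \<Rightarrow> 'b"
    using that assms(3) by (induction k arbitrary: g) (auto intro: continuous_on_subset)
  then show ?thesis using assms by (auto simp: smooth_on_def)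
qed

named_theorems smooth_rules

lemma smooth_on_const [smooth_rules]: "open S \<Longrightarrow> smooth_on S (\<lambda>x. c)"
  and smooth_on_ident [smooth_rules]: "open T \<Longrightarrow> smooth_on T (\<lambda>x. x)"
  by (auto simp: smooth_on_def Ck_on_const Ck_on_ident)

lemma smooth_on_add [smooth_rules]:
  "smooth_on S f \<Longrightarrow> smooth_on S g \<Longrightarrow> smooth_on S (\<lambda>x. f x + g x)"
  by (auto simp: smooth_on_def Ck_on_add)

lemma smooth_on_scaleR [smooth_rules]:
  "smooth_on S f \<Longrightarrow> smooth_on S g \<Longrightarrow> smooth_on S (\<lambda>x. f x *\<^sub>R g x)"
  by (auto simp: smooth_on_def bounded_bilinear.Ck_on[OF bounded_bilinear_scaleR])

lemma smooth_on_mult [smooth_rules]: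
  fixes f g :: "'e::euclidean_space \<Rightarrow> real"
  shows "smooth_on S f \<Longrightarrow> smooth_on S g \<Longrightarrow> smooth_on S (\<lambda>x. f x * g x)"
  using smooth_on_scaleR[of S f g] by simp

lemma smooth_on_inner [smooth_rules]:
  "smooth_on S f \<Longrightarrow> smooth_on S g \<Longrightarrow> smooth_on S (\<lambda>x. f x \<bullet> g x)"
  by (auto simp: smooth_on_def bounded_bilinear.Ck_on[OF bounded_bilinear_inner])

lemma smooth_on_minus [smooth_rules]:
  "smooth_on S f \<Longrightarrow> smooth_on S (\<lambda>x. - f x)"
  using smooth_on_scaleR[OF smooth_on_const[of S "- 1 :: real"], of f] smooth_onD(1)[of S f] by simp

lemma smooth_on_diff [smooth_rules]:
  "smooth_on S f \<Longrightarrow> smooth_on S g \<Longrightarrow> smooth_on S (\<lambda>x. f x - g x)"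
  using smooth_on_add[OF _ smooth_on_minus, of S f g] by simp

lemma smooth_on_sum [smooth_rules]:
  "open S \<Longrightarrow> (\<And>i. i \<in> I \<Longrightarrow> smooth_on S (f i)) \<Longrightarrow> smooth_on S (\<lambda>x. \<Sum>i\<in>I. f i x)"
  by (auto simp: smooth_on_def Ck_on_sum)

lemma smooth_on_divide:
  fixes f g :: "'e::euclidean_space \<Rightarrow> real"
  assumes "smooth_on S f" "smooth_on S g" "\<And>x. x \<in> S \<Longrightarrow> g x \<noteq> 0"
  shows "smooth_on S (\<lambda>x. f x / g x)"
proof -
  have "smooth_on S (\<lambda>x. inverse (g x))"
    using assms by (auto simp: smooth_on_def Ck_on_inverse)
  then show ?thesis
    using smooth_on_mult[OF assms(1)] by (simp add: divide_inverse)
qed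

lemma smooth_on_compose:
  fixes g :: "'e::euclidean_space \<Rightarrow> 'u::euclidean_space"
  shows "smooth_on T f \<Longrightarrow> smooth_on S g \<Longrightarrow> g ` S \<subseteq> T \<Longrightarrow> smooth_on S (\<lambda>x. f (g x))"
  unfolding smooth_on_def using Ck_on_compose[of S g T _ f] by blast

lemma bilinear_expand_Basis:
  fixes B :: "'u::euclidean_space \<Rightarrow> 'v::euclidean_space \<Rightarrow> 'w::real_vector"
  assumes "bilinear B"
  shows "B u v = (\<Sum>i\<in>Basis. \<Sum>j\<in>Basis. ((u \<bullet> i) * (v \<bullet> j)) *\<^sub>R B i j)"
proof -
  have L: "linear (\<lambda>u. B u v)" "linear (B i)" for i
    using assms by (auto simp: bilinear_def)
  have "B u v = (\<Sum>i\<in>Basis. (u \<bullet> i) *\<^sub>R B i v)"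
    by (rule linear_expand_Basis[OF L(1)])
  moreover have "B i v = (\<Sum>j\<in>Basis. (v \<bullet> j) *\<^sub>R B i j)" for i
    by (rule linear_expand_Basis[OF L(2)])
  ultimately show ?thesis
    by (simp add: scaleR_sum_right)
qed

lemma smooth_on_bilinear_field:
  fixes U :: "'e::euclidean_space \<Rightarrow> 'u::euclidean_space" and V :: "'e \<Rightarrow> 'v::euclidean_space"
    and f :: "'e \<Rightarrow> 'p::euclidean_space"
  assumes "\<And>q. q \<in> S \<Longrightarrow> bilinear (B q)" "\<And>u v. smooth_on S (\<lambda>q. B q u v)"
    and "smooth_on W f" "f ` W \<subseteq> S" "smooth_on W U" "smooth_on W V"
  shows "smooth_on W (\<lambda>x. B (f x) (U x) (V x))"
proof -
  have "smooth_on W (\<lambda>x. \<Sum>i\<in>Basis. \<Sum>j\<in>Basis. ((U x \<bullet> i) * (V x \<bullet> j)) *\<^sub>R B (f x) i j)"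
    using assms smooth_onD(1)[OF assms(3)]
    by (intro smooth_rules smooth_on_compose[OF assms(2), of W f])
  then show ?thesis
    by (rule smooth_on_cong[THEN iffD1, rotated])
      (rule bilinear_expand_Basis[symmetric], rule assms(1), use assms(4) in blast)
qed

lemma smooth_on_deriv_at [smooth_rules]:
  assumes "smooth_on W f" "smooth_on W X"
  shows "smooth_on W (\<lambda>x. deriv_at f x (X x))"
proof -
  have "smooth_on W (\<lambda>x. \<Sum>i\<in>Basis. (X x \<bullet> i) *\<^sub>R deriv_at f x i)"
    using smooth_onD[OF assms(1)] assms(2) by (intro smooth_rules)
  then show ?thesis
    by (rule smooth_on_cong[THEN iffD1, rotated])
      (rule linear_expand_Basis[OF linear_frechet_derivative[OF smooth_onD(2)[OF assms(1)]], symmetric])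
qed



text \<open>The product rule for a field \<open>B\<close> of bilinear maps evaluated along \<open>f\<close>.\<close>

lemma bilinear_field_has_derivative:
  fixes B :: "'p::euclidean_space \<Rightarrow> 'u::euclidean_space \<Rightarrow> 'v::euclidean_space \<Rightarrow> 'w::real_normed_vector"
    and f :: "'e::euclidean_space \<Rightarrow> 'p"
  assumes B: "\<And>q. q \<in> S \<Longrightarrow> bilinear (B q)" "\<And>u v. (\<lambda>q. B q u v) differentiable at (f x)"
    and W: "open S" "open W" "x \<in> W" "f ` W \<subseteq> S"
    and f: "(f has_derivative f') (at x)"
    and U: "(U has_derivative U') (at x)" and V: "(V has_derivative V') (at x)"
  shows "((\<lambda>y. B (f y) (U y) (V y)) has_derivative
     (\<lambda>h. deriv_at (\<lambda>q. B q (U x) (V x)) (f x) (f' h) + B (f x) (U' h) (V x) + B (f x) (U x) (V' h)))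
     (at x)"
proof -
  have fx: "f x \<in> S" using W by blast
  have D: "((\<lambda>y. B (f y) i j) has_derivative (\<lambda>h. deriv_at (\<lambda>q. B q i j) (f x) (f' h))) (at x)" for i j
    using has_derivative_compose[OF f B(2)[of i j, unfolded frechet_derivative_works]] .
  have "((\<lambda>y. \<Sum>i\<in>Basis. \<Sum>j\<in>Basis. ((U y \<bullet> i) * (V y \<bullet> j)) *\<^sub>R B (f y) i j) has_derivative
     (\<lambda>h. \<Sum>i\<in>Basis. \<Sum>j\<in>Basis. ((U x \<bullet> i) * (V x \<bullet> j)) *\<^sub>R deriv_at (\<lambda>q. B q i j) (f x) (f' h)
        + ((U x \<bullet> i) * (V' h \<bullet> j) + (U' h \<bullet> i) * (V x \<bullet> j)) *\<^sub>R B (f x) i j)) (at x)"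
    by (intro has_derivative_sum has_derivative_scaleR has_derivative_mult has_derivative_inner_left U V D)
  also have "(\<lambda>h. \<Sum>i\<in>Basis. \<Sum>j\<in>Basis. ((U x \<bullet> i) * (V x \<bullet> j)) *\<^sub>R deriv_at (\<lambda>q. B q i j) (f x) (f' h)
        + ((U x \<bullet> i) * (V' h \<bullet> j) + (U' h \<bullet> i) * (V x \<bullet> j)) *\<^sub>R B (f x) i j)
    = (\<lambda>h. (\<Sum>i\<in>Basis. \<Sum>j\<in>Basis. ((U x \<bullet> i) * (V x \<bullet> j)) *\<^sub>R deriv_at (\<lambda>q. B q i j) (f x) (f' h))
       + B (f x) (U' h) (V x) + B (f x) (U x) (V' h))"
    unfolding bilinear_expand_Basis[OF B(1)[OF fx], of "U x"]
      bilinear_expand_Basis[OF B(1)[OF fx], of "U' _"] sum.distrib[symmetric]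
    by (intro ext sum.cong refl) (simp add: scaleR_add_left)
  finally have 1: "((\<lambda>y. B (f y) (U y) (V y)) has_derivative \<dots>) (at x)"
    by (rule has_derivative_transform_within_open[OF _ W(2,3)])
      (rule bilinear_expand_Basis[symmetric], rule B(1), use W in blast)
  let ?D = "\<lambda>k. \<Sum>i\<in>Basis. \<Sum>j\<in>Basis. ((U x \<bullet> i) * (V x \<bullet> j)) *\<^sub>R deriv_at (\<lambda>q. B q i j) (f x) k"
  have "((\<lambda>q. \<Sum>i\<in>Basis. \<Sum>j\<in>Basis. ((U x \<bullet> i) * (V x \<bullet> j)) *\<^sub>R B q i j) has_derivative
     (\<lambda>k. \<Sum>i\<in>Basis. \<Sum>j\<in>Basis. ((U x \<bullet> i) * (V x \<bullet> j)) *\<^sub>R deriv_at (\<lambda>q. B q i j) (f x) k)) (at (f x))"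
    by (intro has_derivative_sum has_derivative_scaleR_right) (use B(2) in \<open>simp add: frechet_derivative_works\<close>)
  then have "((\<lambda>q. B q (U x) (V x)) has_derivative ?D) (at (f x))"
    by (rule has_derivative_transform_within_open[OF _ W(1) fx])
      (rule bilinear_expand_Basis[symmetric], rule B(1))
  then have "deriv_at (\<lambda>q. B q (U x) (V x)) (f x) = ?D"
    by (rule frechet_derivative_at[symmetric])
  with 1 show ?thesis
    by simp
qed

section \<open>Symmetry of second derivatives\<close>

lemma DERIV_along_line:
  fixes f :: "'e::euclidean_space \<Rightarrow> real"
  assumes "f differentiable at (p + s *\<^sub>R u)"
  shows "((\<lambda>s. f (p + s *\<^sub>R u)) has_real_derivative deriv_at f (p + s *\<^sub>R u) u) (at s)"
proof -
  let ?D = "deriv_at f (p + s *\<^sub>R u)"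
  have f: "(f has_derivative ?D) (at (p + s *\<^sub>R u))"
    using assms by (simp add: frechet_derivative_works)
  have "((\<lambda>s. p + s *\<^sub>R u) has_derivative (\<lambda>h. h *\<^sub>R u)) (at s)"
    by (auto intro!: derivative_eq_intros)
  from has_derivative_compose[OF this f] show ?thesis
    by (simp add: has_field_derivative_def linear_cmul[OF has_derivative_linear[OF f]] mult_commute_abs)
qed

text \<open>The mean value theorem in both directions: the key to the symmetry of second derivatives.\<close>

lemma second_difference_mean_value:
  fixes f :: "'e::euclidean_space \<Rightarrow> real"
  assumes f: "smooth_on S f" and "0 < t"
    and S: "\<And>\<xi> \<eta>. 0 \<le> \<xi> \<Longrightarrow> \<xi> \<le> t \<Longrightarrow> 0 \<le> \<eta> \<Longrightarrow> \<eta> \<le> t \<Longrightarrow> x + \<xi> *\<^sub>R u + \<eta> *\<^sub>R v \<in> S"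
  obtains \<xi> \<eta> where "0 < \<xi>" "\<xi> < t" "0 < \<eta>" "\<eta> < t"
    "f (x + t *\<^sub>R u + t *\<^sub>R v) - f (x + t *\<^sub>R u) - f (x + t *\<^sub>R v) + f x
      = t * (t * deriv_at (\<lambda>y. deriv_at f y u) (x + \<xi> *\<^sub>R u + \<eta> *\<^sub>R v) v)"
proof -
  note D = smooth_onD(2)[OF f] smooth_onD(2)[OF smooth_onD(4)[OF f]]
  have 1: "((\<lambda>s. f (x + t *\<^sub>R v + s *\<^sub>R u) - f (x + s *\<^sub>R u)) has_real_derivative
      deriv_at f (x + t *\<^sub>R v + s *\<^sub>R u) u - deriv_at f (x + s *\<^sub>R u) u) (at s)"
    if "0 \<le> s" "s \<le> t" for s
    using S[of s t] S[of s 0] that \<open>0 < t\<close>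
    by (intro DERIV_diff DERIV_along_line D) (auto simp: ac_simps)
  obtain \<xi> where \<xi>: "0 < \<xi>" "\<xi> < t" and a:
    "f (x + t *\<^sub>R v + t *\<^sub>R u) - f (x + t *\<^sub>R u) - (f (x + t *\<^sub>R v + 0 *\<^sub>R u) - f (x + 0 *\<^sub>R u))
     = (t - 0) * (deriv_at f (x + t *\<^sub>R v + \<xi> *\<^sub>R u) u - deriv_at f (x + \<xi> *\<^sub>R u) u)"
    using MVT2[OF \<open>0 < t\<close> 1] by auto
  have 2: "((\<lambda>s. deriv_at f (x + \<xi> *\<^sub>R u + s *\<^sub>R v) u) has_real_derivative
      deriv_at (\<lambda>y. deriv_at f y u) (x + \<xi> *\<^sub>R u + s *\<^sub>R v) v) (at s)"
    if "0 \<le> s" "s \<le> t" for s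
    using S[of \<xi> s] that \<xi> by (intro DERIV_along_line D) auto
  obtain \<eta> where \<eta>: "0 < \<eta>" "\<eta> < t" and b:
    "deriv_at f (x + \<xi> *\<^sub>R u + t *\<^sub>R v) u - deriv_at f (x + \<xi> *\<^sub>R u + 0 *\<^sub>R v) u
     = (t - 0) * deriv_at (\<lambda>y. deriv_at f y u) (x + \<xi> *\<^sub>R u + \<eta> *\<^sub>R v) v"
    using MVT2[OF \<open>0 < t\<close> 2] by auto
  show ?thesis
    using that[OF \<xi> \<eta>] a b by (simp add: ac_simps)
qed

lemma symmetric_second_derivative_real:
  fixes f :: "'e::euclidean_space \<Rightarrow> real"
  assumes f: "smooth_on S f" and x: "x \<in> S"
  shows "deriv_at (\<lambda>y. deriv_at f y u) x v = deriv_at (\<lambda>y. deriv_at f y v) x u"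
proof (rule ccontr)
  \<comment> \<open>Both mixed derivatives are limits of the same symmetric second difference quotient.\<close>
  define A where "A y = deriv_at (\<lambda>y. deriv_at f y u) y v" for y
  define B where "B y = deriv_at (\<lambda>y. deriv_at f y v) y u" for y
  assume "\<not> ?thesis"
  then have e: "0 < \<bar>A x - B x\<bar> / 2"
    by (simp add: A_def B_def)
  have "smooth_on S A" "smooth_on S B"
    unfolding A_def B_def by (intro smooth_onD(4) f)+
  then have "isCont A x" "isCont B x"
    using smooth_onD(2) x by (blast intro: differentiable_imp_continuous_within)+
  note this[unfolded continuous_at_eps_delta, rule_format, OF e]
  then obtain d1 d2 where d: "0 < d1" "0 < d2"
    "\<And>y. dist y x < d1 \<Longrightarrow> dist (A y) (A x) < \<bar>A x - B x\<bar> / 2"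
    "\<And>y. dist y x < d2 \<Longrightarrow> dist (B y) (B x) < \<bar>A x - B x\<bar> / 2"
    by (elim exE conjE) simp
  obtain d3 where d3: "0 < d3" "\<And>y. dist y x < d3 \<Longrightarrow> y \<in> S"
    using smooth_onD(1)[OF f] x unfolding open_dist by blast
  define d where "d = min d1 (min d2 d3)"
  define t where "t = d / (norm u + norm v + 1)"
  have "0 < d" using d d3 by (simp add: d_def)
  have n: "0 < norm u + norm v + 1"
    using norm_ge_zero[of u] norm_ge_zero[of v] by linarith
  then have "0 < t" using \<open>0 < d\<close> by (simp add: t_def)
  have near: "dist (x + \<xi> *\<^sub>R u + \<eta> *\<^sub>R v) x < d"
    if "0 \<le> \<xi>" "\<xi> \<le> t" "0 \<le> \<eta>" "\<eta> \<le> t" for \<xi> \<eta>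
  proof -
    have "dist (x + \<xi> *\<^sub>R u + \<eta> *\<^sub>R v) x \<le> \<xi> * norm u + \<eta> * norm v"
      using norm_triangle_ineq[of "\<xi> *\<^sub>R u" "\<eta> *\<^sub>R v"] that by (simp add: dist_norm add.assoc)
    also have "\<dots> \<le> t * norm u + t * norm v"
      using that by (intro add_mono mult_right_mono) auto
    also have "\<dots> < t * (norm u + norm v + 1)"
      using \<open>0 < t\<close> by (simp add: algebra_simps)
    also have "\<dots> = d"
      using n by (simp add: t_def)
    finally show ?thesis .
  qed
  have inS: "x + \<xi> *\<^sub>R u + \<eta> *\<^sub>R v \<in> S" "x + \<eta> *\<^sub>R v + \<xi> *\<^sub>R u \<in> S"
    if "0 \<le> \<xi>" "\<xi> \<le> t" "0 \<le> \<eta>" "\<eta> \<le> t" for \<xi> \<eta>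
    using near[OF that] d3(2) by (auto simp: d_def ac_simps)
  obtain \<xi> \<eta> where 1: "0 < \<xi>" "\<xi> < t" "0 < \<eta>" "\<eta> < t"
    "f (x + t *\<^sub>R u + t *\<^sub>R v) - f (x + t *\<^sub>R u) - f (x + t *\<^sub>R v) + f x = t * (t * A (x + \<xi> *\<^sub>R u + \<eta> *\<^sub>R v))"
    unfolding A_def using second_difference_mean_value[OF f \<open>0 < t\<close> inS(1)] by blast
  obtain \<xi>' \<eta>' where 2: "0 < \<xi>'" "\<xi>' < t" "0 < \<eta>'" "\<eta>' < t"
    "f (x + t *\<^sub>R v + t *\<^sub>R u) - f (x + t *\<^sub>R v) - f (x + t *\<^sub>R u) + f x = t * (t * B (x + \<xi>' *\<^sub>R v + \<eta>' *\<^sub>R u))"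
    unfolding B_def using second_difference_mean_value[OF f \<open>0 < t\<close> inS(2)] by blast
  have "x + t *\<^sub>R v + t *\<^sub>R u = x + t *\<^sub>R u + t *\<^sub>R v"
    by simp
  then have "f (x + t *\<^sub>R v + t *\<^sub>R u) = f (x + t *\<^sub>R u + t *\<^sub>R v)"
    by (rule arg_cong)
  then have "t * (t * A (x + \<xi> *\<^sub>R u + \<eta> *\<^sub>R v)) = t * (t * B (x + \<xi>' *\<^sub>R v + \<eta>' *\<^sub>R u))"
    using 1(5) 2(5) by linarith
  moreover have "x + \<xi>' *\<^sub>R v + \<eta>' *\<^sub>R u = x + \<eta>' *\<^sub>R u + \<xi>' *\<^sub>R v"
    by simp
  ultimately have eq: "A (x + \<xi> *\<^sub>R u + \<eta> *\<^sub>R v) = B (x + \<eta>' *\<^sub>R u + \<xi>' *\<^sub>R v)"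
    using \<open>0 < t\<close> by simp
  have "dist (A (x + \<xi> *\<^sub>R u + \<eta> *\<^sub>R v)) (A x) < \<bar>A x - B x\<bar> / 2"
    "dist (B (x + \<eta>' *\<^sub>R u + \<xi>' *\<^sub>R v)) (B x) < \<bar>A x - B x\<bar> / 2"
    using near[of \<xi> \<eta>] near[of \<eta>' \<xi>'] 1 2 d by (auto simp: d_def)
  moreover have "\<bar>a - b\<bar> \<le> \<bar>q - a\<bar> + \<bar>q - b\<bar>" for a b q :: real
    by arith
  ultimately show False
    unfolding eq dist_real_def by (metis add_strict_mono field_sum_of_halves not_less)
qed

lemma symmetric_second_derivative:
  fixes f :: "'e::euclidean_space \<Rightarrow> 'f::euclidean_space"
  assumes f: "smooth_on S f" and x: "x \<in> S"
  shows "deriv_at (\<lambda>y. deriv_at f y u) x v = deriv_at (\<lambda>y. deriv_at f y v) x u"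
proof (rule euclidean_eqI)
  fix b :: 'f assume "b \<in> Basis"
  have 1: "deriv_at (\<lambda>y. g y \<bullet> b) y v = deriv_at g y v \<bullet> b" if "smooth_on S g" "y \<in> S"
    for g :: "'e \<Rightarrow> 'f" and y v
    using has_derivative_inner_left[OF smooth_onD(3)[OF that], of b, THEN frechet_derivative_at] by metis
  have 2: "deriv_at (\<lambda>y. deriv_at f y u) x v \<bullet> b = deriv_at (\<lambda>y. deriv_at (\<lambda>y. f y \<bullet> b) y u) x v" for u v
  proof -
    have "deriv_at (\<lambda>y. deriv_at f y u \<bullet> b) x = deriv_at (\<lambda>y. deriv_at (\<lambda>y. f y \<bullet> b) y u) x"
      using 1[OF f] smooth_onD[OF smooth_onD(4)[OF f]] x
      by (intro frechet_derivative_transform_within_open[of _ _ S]) (auto intro!: derivative_intros)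
    from trans[OF 1[OF smooth_onD(4)[OF f] x, symmetric] fun_cong[OF this]] show ?thesis .
  qed
  have "smooth_on S (\<lambda>y. f y \<bullet> b)"
    using smooth_onD(1)[OF f] f by (intro smooth_rules)
  from symmetric_second_derivative_real[OF this x]
  show "deriv_at (\<lambda>y. deriv_at f y u) x v \<bullet> b = deriv_at (\<lambda>y. deriv_at f y v) x u \<bullet> b"
    unfolding 2 .
qed

section \<open>Smoothness of the Christoffel symbols\<close>

lemma metric_eqI:
  assumes "riemannian_metric_on S G" "x \<in> S" "\<And>z. G x a z = G x b z"
  shows "a = b"
  using riemannian_metric_onD(3)[OF assms(1,2), of "a - b"] assms(3)
    bilinear_lsub[OF riemannian_metric_onD(1)[OF assms(1,2)]] by force

lemma metric_smooth:
  assumes "riemannian_metric_on S G" "smooth_on W f" "f ` W \<subseteq> S" "smooth_on W U" "smooth_on W V"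
  shows "smooth_on W (\<lambda>x. G (f x) (U x) (V x))"
  using assms smooth_on_bilinear_field[of S G W f U V] unfolding riemannian_metric_on_def by blast

lemma bilinear_simps:
  assumes "bilinear B"
  shows "B (a + b) c = B a c + B b c" "B c (a + b) = B c a + B c b"
    "B (r *\<^sub>R a) c = r *\<^sub>R B a c" "B c (r *\<^sub>R a) = r *\<^sub>R B c a"
    "B (a - b) c = B a c - B b c" "B c (a - b) = B c a - B c b"
    "B (- a) c = - B a c" "B c (- a) = - B c a" "B 0 c = 0" "B c 0 = 0"
    "B (sum g I) c = (\<Sum>i\<in>I. B (g i) c)" "B c (sum g I) = (\<Sum>i\<in>I. B c (g i))"
  using assms linear_sum[of "B c"] linear_sum[of "\<lambda>a. B a c"]
  by (auto simp: bilinear_ladd bilinear_radd bilinear_lmul bilinear_rmul bilinear_lsub bilinear_rsub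
      bilinear_lneg bilinear_rneg bilinear_lzero bilinear_rzero bilinear_def)

text \<open>The Gram--Schmidt process, applied to a part \<open>B\<close> of the standard basis at all points of \<open>S\<close> at once.
  The fields are orthogonal but not normalised, so that only rational operations occur.\<close>

lemma orthogonal_field_exists:
  fixes G :: "'e::euclidean_space metric_field"
  assumes G: "riemannian_metric_on S G" and "B \<subseteq> Basis" and S: "open S"
  obtains E :: "'e \<Rightarrow> 'e \<Rightarrow> 'e" where "\<And>b. b \<in> B \<Longrightarrow> smooth_on S (E b)"
    "\<And>x b. x \<in> S \<Longrightarrow> b \<in> B \<Longrightarrow> E b x \<noteq> 0"
    "\<And>x b c. x \<in> S \<Longrightarrow> b \<in> B \<Longrightarrow> c \<in> B \<Longrightarrow> b \<noteq> c \<Longrightarrow> G x (E b x) (E c x) = 0"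
    "\<And>x. x \<in> S \<Longrightarrow> span ((\<lambda>b. E b x) ` B) = span B"
proof -
  have "finite B" using assms(2) finite_Basis finite_subset by blast
  then have "\<exists>E::'e \<Rightarrow> 'e \<Rightarrow> 'e. (\<forall>b\<in>B. smooth_on S (E b)) \<and> (\<forall>x\<in>S. (\<forall>b\<in>B. E b x \<noteq> 0) \<and>
     (\<forall>b\<in>B. \<forall>c\<in>B. b \<noteq> c \<longrightarrow> G x (E b x) (E c x) = 0) \<and> span ((\<lambda>b. E b x) ` B) = span B)"
    using assms(2)
  proof (induction B)
    case empty
    then show ?case by simp
  next
    case (insert b B)
    then obtain E :: "'e \<Rightarrow> 'e \<Rightarrow> 'e" where IH: "\<forall>b\<in>B. smooth_on S (E b)"
      "\<forall>x\<in>S. (\<forall>b\<in>B. E b x \<noteq> 0) \<and> (\<forall>b\<in>B. \<forall>c\<in>B. b \<noteq> c \<longrightarrow> G x (E b x) (E c x) = 0) \<and>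
        span ((\<lambda>b. E b x) ` B) = span B"
      by (elim meta_impE conjE exE) simp_all
    then have E: "\<And>b. b \<in> B \<Longrightarrow> smooth_on S (E b)"
      "\<And>x b. x \<in> S \<Longrightarrow> b \<in> B \<Longrightarrow> E b x \<noteq> 0"
      "\<And>x b c. x \<in> S \<Longrightarrow> b \<in> B \<Longrightarrow> c \<in> B \<Longrightarrow> b \<noteq> c \<Longrightarrow> G x (E b x) (E c x) = 0"
      "\<And>x. x \<in> S \<Longrightarrow> span ((\<lambda>b. E b x) ` B) = span B"
      by auto
    \<comment> \<open>\<open>P x\<close> is the orthogonal projection of \<open>b\<close> to the span of the fields already found.\<close>
    define P where "P x = (\<Sum>c\<in>B. (G x b (E c x) / G x (E c x) (E c x)) *\<^sub>R E c x)" for x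
    define F where "F c x = (if c = b then b - P x else E c x)" for c x
    note D = riemannian_metric_onD[OF G]
    have pos: "G x (E c x) (E c x) \<noteq> 0" if "x \<in> S" "c \<in> B" for x c
      using D(3)[OF that(1) E(2)[OF that]] by simp
    have smP: "smooth_on S (\<lambda>x. b - P x)"
      unfolding P_def using E(1) pos S
      by (intro smooth_rules smooth_on_divide metric_smooth[OF G, where f = "\<lambda>x. x"]) auto
    have P_span: "P x \<in> span B" if "x \<in> S" for x
      unfolding P_def E(4)[OF that, symmetric] by (intro span_sum span_scale span_base) auto
    have "b \<notin> span B"
    proof
      assume "b \<in> span B"
      then have "b \<in> span (Basis - {b})"
        using insert.hyps insert.prems span_mono[of B "Basis - {b}"] by blast
      then show False
        using independent_Basis insert.prems unfolding dependent_def by blast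
    qed
    then have nz: "b - P x \<noteq> 0" if "x \<in> S" for x
      using P_span[OF that] by auto
    have orth: "G x (b - P x) (E c x) = 0" if "x \<in> S" "c \<in> B" for x c
    proof -
      have "G x (P x) (E c x) = (\<Sum>c'\<in>B. if c' = c then G x b (E c x) else 0)"
        unfolding P_def bilinear_simps[OF D(1)[OF that(1)]]
        by (intro sum.cong refl) (use E(3) pos that in auto)
      then show ?thesis
        using insert.hyps(1) that(2) by (simp add: bilinear_simps[OF D(1)[OF that(1)]])
    qed
    have orth': "G x (E c x) (b - P x) = 0" if "x \<in> S" "c \<in> B" for x c
      using orth[OF that] D(2)[OF that(1)] by simp
    have span: "span ((\<lambda>c. F c x) ` insert b B) = span (insert b B)" if "x \<in> S" for x
    proof -
      have "(\<lambda>c. F c x) ` insert b B = insert (b - P x) ((\<lambda>c. E c x) ` B)"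
        using insert.hyps by (auto simp: F_def image_def)
      also have "span \<dots> = span (insert (b - P x) B)"
        using E(4)[OF that] by (simp add: span_insert)
      also have "\<dots> = span (insert b B)"
      proof (rule span_eq[THEN iffD2], intro conjI insert_subset[THEN iffD2] subsetI)
        have P: "P x \<in> span (insert c B)" for c
          using P_span[OF that] span_mono[of B "insert c B"] by blast
        show "b - P x \<in> span (insert b B)"
          by (intro span_diff P span_base) simp
        have "b - P x + P x \<in> span (insert (b - P x) B)"
          by (intro span_add P span_base) simp
        then show "b \<in> span (insert (b - P x) B)"
          by simp
      qed (auto intro: span_base)
      finally show ?thesis .
    qed
    have "smooth_on S (F c)" if "c \<in> insert b B" for c
      using that E(1) smP by (cases "c = b") (auto simp: F_def[abs_def])
    moreover have "G x (F c x) (F c' x) = 0"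
      if "x \<in> S" "c \<in> insert b B" "c' \<in> insert b B" "c \<noteq> c'" for x c c'
      using that orth orth' E(3) insert.hyps by (auto simp: F_def)
    moreover have "F c x \<noteq> 0" if "x \<in> S" "c \<in> insert b B" for x c
      using that nz E(2) by (auto simp: F_def)
    ultimately show ?case
      using span by (intro exI[of _ F] conjI ballI impI)
  qed
  then obtain E :: "'e \<Rightarrow> 'e \<Rightarrow> 'e" where "\<forall>b\<in>B. smooth_on S (E b)"
    "\<forall>x\<in>S. (\<forall>b\<in>B. E b x \<noteq> 0) \<and> (\<forall>b\<in>B. \<forall>c\<in>B. b \<noteq> c \<longrightarrow> G x (E b x) (E c x) = 0) \<and>
      span ((\<lambda>b. E b x) ` B) = span B"
    by (elim conjE exE)
  then show thesis by (intro that[of E]) auto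
qed

text \<open>A vector field is smooth as soon as its metric pairings with constant fields are.\<close>

lemma smooth_on_by_metric:
  fixes G :: "'e::euclidean_space metric_field"
  assumes G: "riemannian_metric_on S G" and S: "open S" and "\<And>z. smooth_on S (\<lambda>x. G x (w x) z)"
  shows "smooth_on S w"
proof -
  note D = riemannian_metric_onD[OF G]
  obtain E :: "'e \<Rightarrow> 'e \<Rightarrow> 'e" where E: "\<And>b. b \<in> Basis \<Longrightarrow> smooth_on S (E b)"
    "\<And>x b. x \<in> S \<Longrightarrow> b \<in> Basis \<Longrightarrow> E b x \<noteq> 0"
    "\<And>x b c. x \<in> S \<Longrightarrow> b \<in> Basis \<Longrightarrow> c \<in> Basis \<Longrightarrow> b \<noteq> c \<Longrightarrow> G x (E b x) (E c x) = 0"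
    "\<And>x. x \<in> S \<Longrightarrow> span ((\<lambda>b. E b x) ` Basis) = span Basis"
    by (rule orthogonal_field_exists[OF G order_refl S]) (rule that, blast+)
  have pos: "G x (E c x) (E c x) \<noteq> 0" if "x \<in> S" "c \<in> Basis" for x c
    using D(3)[OF that(1) E(2)[OF that]] by simp
  \<comment> \<open>\<open>w'\<close> is the expansion of \<open>w\<close> in the orthogonal frame \<open>E\<close>.\<close>
  define w' where "w' x = (\<Sum>b\<in>Basis. (G x (w x) (E b x) / G x (E b x) (E b x)) *\<^sub>R E b x)" for x
  have "w' x = w x" if x: "x \<in> S" for x
  proof -
    note B = bilinear_simps[OF D(1)[OF x]]
    have "G x (w' x - w x) (E c x) = 0" if "c \<in> Basis" for c
    proof -
      have "G x (w' x) (E c x) = (\<Sum>b\<in>Basis. if b = c then G x (w x) (E c x) else 0)"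
        unfolding w'_def B by (intro sum.cong refl) (use E(3) pos that x in auto)
      then show ?thesis
        using that by (simp add: B)
    qed
    moreover have "subspace {z. G x (w' x - w x) z = 0}"
      by (simp add: subspace_def B)
    ultimately have "span ((\<lambda>b. E b x) ` Basis) \<subseteq> {z. G x (w' x - w x) z = 0}"
      by (intro span_minimal) auto
    then have "G x (w' x - w x) (w' x - w x) = 0"
      by (auto simp: E(4)[OF x])
    then show ?thesis
      using D(3)[OF x, of "w' x - w x"] by force
  qed
  moreover have Gw: "smooth_on S (\<lambda>x. G x (w x) (E b x))" if "b \<in> Basis" for b
  proof -
    have "smooth_on S (\<lambda>x. \<Sum>c\<in>Basis. (E b x \<bullet> c) *\<^sub>R G x (w x) c)"
      by (intro smooth_rules S E(1) that assms(3))
    then show ?thesis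
      by (rule smooth_on_cong[THEN iffD1, rotated])
        (rule linear_expand_Basis[symmetric], use D(1) in \<open>simp add: bilinear_def\<close>)
  qed
  then have "smooth_on S w'"
    unfolding w'_def using E(1) pos S
    by (intro smooth_rules smooth_on_divide[OF Gw] metric_smooth[OF G, where f = "\<lambda>x. x"]) auto
  ultimately show ?thesis
    using smooth_on_cong[of S w' w] by blast
qed

lemma christoffel_smooth:
  fixes G :: "'e::euclidean_space metric_field"
  assumes G: "riemannian_metric_on S G" and S: "open S"
  shows "smooth_on S (\<lambda>x. christoffel G x u v)"
proof (rule smooth_on_by_metric[OF G S])
  fix z
  have sm: "smooth_on S (\<lambda>x. G x a b)" for a b
    using G by (auto simp: riemannian_metric_on_def)
  have "smooth_on S (\<lambda>x. (1 / 2) * (deriv_at (\<lambda>y. G y v z) x u + deriv_at (\<lambda>y. G y u z) x v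
      - deriv_at (\<lambda>y. G y u v) x z))"
    by (intro smooth_rules S sm)
  then show "smooth_on S (\<lambda>x. G x (christoffel G x u v) z)"
    by (rule smooth_on_cong[THEN iffD1, rotated]) (simp add: koszul[OF G, symmetric])
qed

lemma christoffel_bilinear:
  fixes G :: "'e::euclidean_space metric_field"
  assumes G: "riemannian_metric_on S G" and x: "x \<in> S"
  shows "bilinear (christoffel G x)"
proof -
  note D = riemannian_metric_onD[OF G x]
  note B = bilinear_simps[OF D(1)]
  let ?F = "\<lambda>u v z. deriv_at (\<lambda>y. G y v z) x u + deriv_at (\<lambda>y. G y u z) x v - deriv_at (\<lambda>y. G y u v) x z"
  have F: "linear (\<lambda>v. ?F u v z)" for u z
    using deriv_at_metric_linear[OF G x] deriv_at_metric_sym[OF G x, of _ z]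
      linear_frechet_derivative[OF D(5)]
    by (intro linear_compose_add linear_compose_sub) auto
  have lin: "linear (christoffel G x u)" for u
  proof
    show "christoffel G x u (a + b) = christoffel G x u a + christoffel G x u b" for a b
    proof (rule metric_eqI[OF G x])
      show "G x (christoffel G x u (a + b)) z = G x (christoffel G x u a + christoffel G x u b) z" for z
        using linear_add[OF F[of z u], of a b] koszul[OF G x, of u a z] koszul[OF G x, of u b z]
          koszul[OF G x, of u "a + b" z] B(1)[of "christoffel G x u a" "christoffel G x u b" z]
        by linarith
    qed
    show "christoffel G x u (r *\<^sub>R b) = r *\<^sub>R christoffel G x u b" for r b
    proof (rule metric_eqI[OF G x])
      show "G x (christoffel G x u (r *\<^sub>R b)) z = G x (r *\<^sub>R christoffel G x u b) z" for z
        using linear_cmul[OF F[of z u], of r b, folded koszul[OF G x]] by (simp add: B)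
    qed
  qed
  moreover have "(\<lambda>v. christoffel G x v u) = christoffel G x u" for u
    using christoffel_torsion_free[OF G x] by auto
  ultimately show ?thesis
    by (simp add: bilinear_def)
qed

section \<open>Metric connections and the curvature tensor\<close>

text \<open>The pull-back connection is metric.\<close>

lemma pullback_deriv_metric:
  fixes f :: "'e::euclidean_space \<Rightarrow> 'f::euclidean_space"
  assumes H: "riemannian_metric_on T H" and W: "open W" "x \<in> W" "f ` W \<subseteq> T"
    and f: "f differentiable at x" and V: "V differentiable at x" and U: "U differentiable at x"
  shows "((\<lambda>y. H (f y) (V y) (U y)) has_derivative (\<lambda>h.
      H (f x) (pullback_deriv H f (\<lambda>_. h) V x) (U x) + H (f x) (V x) (pullback_deriv H f (\<lambda>_. h) U x))) (at x)"
proof -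
  have fx: "f x \<in> T" using W by blast
  note D = riemannian_metric_onD[OF H]
  have "((\<lambda>y. H (f y) (V y) (U y)) has_derivative
     (\<lambda>h. deriv_at (\<lambda>q. H q (V x) (U x)) (f x) (deriv_at f x h)
       + H (f x) (deriv_at V x h) (U x) + H (f x) (V x) (deriv_at U x h))) (at x)"
    by (rule bilinear_field_has_derivative[OF D(1,5) D(4) W])
      (use fx f U V in \<open>auto simp: frechet_derivative_works[symmetric]\<close>)
  then show ?thesis
    unfolding christoffel_metric[OF H fx] pullback_deriv_def push_def bilinear_simps[OF D(1)[OF fx]]
    by (simp add: algebra_simps)
qed

lemma linear_field_deriv_linear:
  fixes A :: "'p::euclidean_space \<Rightarrow> 'u::real_vector \<Rightarrow> 'w::real_normed_vector"
  assumes S: "open S" "q \<in> S" and A: "\<And>q. q \<in> S \<Longrightarrow> linear (A q)"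
    and diff: "\<And>u. (\<lambda>q. A q u) differentiable at q"
  shows "linear (\<lambda>u. deriv_at (\<lambda>q. A q u) q v)"
proof
  note D = diff[unfolded frechet_derivative_works]
  have 1: "((\<lambda>q. A q (a + b)) has_derivative (\<lambda>v. deriv_at (\<lambda>q. A q a) q v + deriv_at (\<lambda>q. A q b) q v)) (at q)"
    for a b
    by (rule has_derivative_transform_within_open[OF has_derivative_add[OF D D] S])
      (simp add: linear_add[OF A])
  show "deriv_at (\<lambda>q. A q (a + b)) q v = deriv_at (\<lambda>q. A q a) q v + deriv_at (\<lambda>q. A q b) q v" for a b
    using fun_cong[OF frechet_derivative_at[OF 1]] by simp
  have 2: "((\<lambda>q. A q (r *\<^sub>R b)) has_derivative (\<lambda>v. r *\<^sub>R deriv_at (\<lambda>q. A q b) q v)) (at q)" for r b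
    by (rule has_derivative_transform_within_open[OF has_derivative_scaleR_right[OF D] S])
      (simp add: linear_cmul[OF A])
  show "deriv_at (\<lambda>q. A q (r *\<^sub>R b)) q v = r *\<^sub>R deriv_at (\<lambda>q. A q b) q v" for r b
    using fun_cong[OF frechet_derivative_at[OF 2]] by simp
qed

text \<open>A tensor with the symmetries of a Riemannian curvature tensor is determined by its sectional
  values: if \<open>Q(u, v, v, u)\<close> always vanishes, then so does \<open>Q\<close>.\<close>

lemma curvature_like_eq_0:
  fixes Q :: "'e::real_vector \<Rightarrow> 'e \<Rightarrow> 'e \<Rightarrow> 'e \<Rightarrow> real"
  assumes add1: "\<And>a b v w z. Q (a + b) v w z = Q a v w z + Q b v w z"
    and add3: "\<And>u v a b z. Q u v (a + b) z = Q u v a z + Q u v b z"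
    and anti: "\<And>u v w z. Q u v w z = - Q v u w z" "\<And>u v w z. Q u v w z = - Q u v z w"
    and bianchi: "\<And>u v w z. Q u v w z + Q v w u z + Q w u v z = 0"
    and sect: "\<And>u v. Q u v v u = 0"
  shows "Q u v w z = 0"
proof -
  have pair: "Q u v w z = Q w z u v" for u v w z
    using bianchi[of u v w z] bianchi[of v w z u] bianchi[of w z u v] bianchi[of z u v w]
      anti(2)[of v w z u] anti(2)[of w z v u] anti(1)[of z v w u] anti(2)[of v z w u]
      anti(2)[of z u w v] anti(1)[of u w z v] anti(2)[of w u z v] anti(2)[of u v z w]
    by linarith
  have add2: "Q u (a + b) w z = Q u a w z + Q u b w z" for u a b w z
    using add1[of a b u w z] anti(1)[of u "a + b" w z] anti(1)[of u a w z] anti(1)[of u b w z]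
    by linarith
  have add4: "Q u v w (a + b) = Q u v w a + Q u v w b" for u v w a b
    using add3[of u v a b w] anti(2)[of u v w "a + b"] anti(2)[of u v w a] anti(2)[of u v w b]
    by linarith
  have 1: "Q u v v u' = 0" for u u' v
  proof -
    have "Q u v v u' + Q u' v v u = 0"
      using sect[of "u + u'" v] sect[of u v] sect[of u' v] by (simp add: add1 add4)
    moreover have "Q u v v u' = Q u' v v u"
      using pair[of u v v u'] anti(1)[of v u' u v] anti(2)[of u' v u v] by linarith
    ultimately show ?thesis by linarith
  qed
  have 2: "Q u v w z = - Q u w v z" for u v w z
    using 1[of u "v + w" z] 1[of u v z] 1[of u w z] by (simp add: add2 add3)
  \<comment> \<open>\<open>Q\<close> is alternating in its first three arguments, so the Bianchi identity reads \<open>3 Q = 0\<close>.\<close>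
  show ?thesis
    using bianchi[of u v w z] 2[of v w u z] anti(1)[of v u w z] anti(1)[of w u v z] 2[of u w v z]
    by linarith
qed

context
  fixes S :: "'f::euclidean_space set" and G :: "'f metric_field" and x :: 'f
  assumes G: "riemannian_metric_on S G" and x: "x \<in> S"
begin

private lemma openS: "open S"
  using riemannian_metric_onD(4)[OF G x] .

text \<open>The second covariant derivative \<open>\<nabla>\<^sub>u(\<nabla>\<^sub>v w)\<close> at \<open>x\<close>, where \<open>u\<close>, \<open>v\<close>, \<open>w\<close> are extended to fields with
  constant components.\<close>

private definition nabla2 :: "'f \<Rightarrow> 'f \<Rightarrow> 'f \<Rightarrow> 'f"
  where "nabla2 u v w = deriv_at (\<lambda>y. christoffel G y v w) x u + christoffel G x u (christoffel G x v w)"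

private lemma Gamma_diff: "(\<lambda>y. christoffel G y u v) differentiable at x"
  using smooth_onD(2)[OF christoffel_smooth[OF G openS] x] .

private lemma Gamma_lin: "y \<in> S \<Longrightarrow> linear (christoffel G y u)" "y \<in> S \<Longrightarrow> linear (\<lambda>u. christoffel G y u v)"
  using christoffel_bilinear[OF G] by (auto simp: bilinear_def)

private lemma nabla2_linear:
  "linear (\<lambda>u. nabla2 u v w)" "linear (\<lambda>v. nabla2 u v w)" "linear (\<lambda>w. nabla2 u v w)"
proof -
  show "linear (\<lambda>u. nabla2 u v w)"
    unfolding nabla2_def
    by (intro linear_compose_add linear_frechet_derivative[OF Gamma_diff] Gamma_lin(2)[OF x])
  show "linear (\<lambda>v. nabla2 u v w)"
    unfolding nabla2_def
    by (intro linear_compose_add linear_field_deriv_linear[OF openS x Gamma_lin(2) Gamma_diff]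
        linear_compose[OF Gamma_lin(2)[OF x] Gamma_lin(1)[OF x], unfolded o_def])
  show "linear (\<lambda>w. nabla2 u v w)"
    unfolding nabla2_def
    by (intro linear_compose_add linear_field_deriv_linear[OF openS x Gamma_lin(1) Gamma_diff]
        linear_compose[OF Gamma_lin(1)[OF x] Gamma_lin(1)[OF x], unfolded o_def])
qed

private lemma curvature_nabla2: "curvature G x u v w = nabla2 u v w - nabla2 v u w"
  by (simp add: curvature_def curvature_field_def cov_deriv_def[abs_def] nabla2_def lie_bracket_def
      bilinear_simps[OF christoffel_bilinear[OF G x]])

private lemma bianchi: "curvature G x u v w + curvature G x v w u + curvature G x w u v = 0"
proof -
  have "nabla2 u v w = nabla2 u w v" for u v w
    unfolding nabla2_def
    using frechet_derivative_transform_within_open[OF Gamma_diff openS x christoffel_torsion_free[OF G]]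
      christoffel_torsion_free[OF G x, of v w] by metis
  then have "nabla2 u v w = nabla2 u w v" "nabla2 v u w = nabla2 v w u" "nabla2 w u v = nabla2 w v u"
    by blast+
  then show ?thesis
    by (simp add: curvature_nabla2)
qed

text \<open>Skew-symmetry in the last two arguments: compare the two mixed second derivatives of \<open>G(w, z)\<close>.\<close>

private lemma skew: "G x (curvature G x u v w) z + G x w (curvature G x u v z) = 0"
proof -
  note D = riemannian_metric_onD[OF G]
  have sm: "smooth_on S (\<lambda>y. G y w z)"
    using G by (auto simp: riemannian_metric_on_def)
  have *: "deriv_at (\<lambda>y. deriv_at (\<lambda>y. G y w z) y v) x u = G x (nabla2 u v w) z + G x w (nabla2 u v z)
      + G x (christoffel G x v w) (christoffel G x u z) + G x (christoffel G x u w) (christoffel G x v z)" for u v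
  proof -
    have "((\<lambda>y. G y (christoffel G y v w) z + G y w (christoffel G y v z)) has_derivative
       (\<lambda>u. G x (nabla2 u v w) z + G x (christoffel G x v w) (christoffel G x u z)
         + (G x (christoffel G x u w) (christoffel G x v z) + G x w (nabla2 u v z)))) (at x)"
      using has_derivative_add[OF
          pullback_deriv_metric[OF G openS x, of "\<lambda>y. y" "\<lambda>y. christoffel G y v w" "\<lambda>y. z"]
          pullback_deriv_metric[OF G openS x, of "\<lambda>y. y" "\<lambda>y. w" "\<lambda>y. christoffel G y v z"]] Gamma_diff
      by (simp add: pullback_deriv_def push_def nabla2_def)
    then have "((\<lambda>y. deriv_at (\<lambda>y. G y w z) y v) has_derivative
       (\<lambda>u. G x (nabla2 u v w) z + G x (christoffel G x v w) (christoffel G x u z)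
         + (G x (christoffel G x u w) (christoffel G x v z) + G x w (nabla2 u v z)))) (at x)"
      by (rule has_derivative_transform_within_open[OF _ openS x]) (simp add: christoffel_metric[OF G])
    from fun_cong[OF frechet_derivative_at[OF this], of u] show ?thesis
      by simp
  qed
  show ?thesis
    using symmetric_second_derivative[OF sm x, of u v] unfolding *
    by (simp add: curvature_nabla2 bilinear_simps[OF D(1)[OF x]])
qed

lemma curvature_constant:
  assumes K: "\<And>u v. u \<noteq> v \<Longrightarrow> independent {u, v} \<Longrightarrow> sectional_curvature G x u v = K"
  shows "curvature G x u v w = K *\<^sub>R (G x v w *\<^sub>R u - G x u w *\<^sub>R v)"
proof -
  note D = riemannian_metric_onD[OF G x]
  note B = bilinear_simps[OF D(1)]
  define Q where "Q u v w z = G x (curvature G x u v w) z - K * (G x v w * G x u z - G x u w * G x v z)" for u v w z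
  have curv_anti: "curvature G x u v w = - curvature G x v u w" for u v w
    by (simp add: curvature_nabla2)
  have Q_anti: "Q u v w z = - Q v u w z" for u v w z
    using curv_anti[of u v w] by (simp add: Q_def B algebra_simps)
  have Q_anti': "Q u v w z = - Q u v z w" for u v w z
    using skew[of u v w z] D(2)[of w "curvature G x u v z"] by (simp add: Q_def algebra_simps)
  have sect: "Q u v v u = 0" for u v
  proof (cases "u \<noteq> v \<and> independent {u, v}")
    case True
    \<comment> \<open>The strict Cauchy--Schwarz inequality for the linearly independent vectors \<open>u\<close> and \<open>v\<close>.\<close>
    have "G x u u * G x v v - (G x u v)\<^sup>2 \<noteq> 0"
    proof -
      have v0: "v \<noteq> 0" using True dependent_zero[of "{u, v}"] by auto
      then have vv: "0 < G x v v" by (rule D(3))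
      define y where "y = G x v v *\<^sub>R u - G x u v *\<^sub>R v"
      have "y \<noteq> 0"
      proof
        assume "y = 0"
        then have "G x v v *\<^sub>R u = G x u v *\<^sub>R v"
          by (simp add: y_def)
        then have "u = (G x u v / G x v v) *\<^sub>R v"
          using vv by (simp add: vector_fraction_eq_iff eq_vector_fraction_iff)
        then have "u \<in> span {v}"
          by (metis span_base span_scale singletonI)
        then show False
          using True by (simp add: independent_insert)
      qed
      then have "0 < G x y y" by (rule D(3))
      also have "G x y y = G x v v * (G x u u * G x v v - (G x u v)\<^sup>2)"
        using D(2)[of v u] by (simp add: y_def B power2_eq_square algebra_simps)
      finally show ?thesis by auto
    qed
    moreover have "sectional_curvature G x u v = K"
      using True by (intro K) auto
    ultimately show ?thesis
      using D(2)[of v u] by (simp add: sectional_curvature_def Q_def field_simps power2_eq_square)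
  next
    case False
    \<comment> \<open>For dependent \<open>u\<close> and \<open>v\<close> the claim follows from skew-symmetry; this covers \<open>u = v\<close>, where
      \<open>{u, v}\<close> may be an independent set.\<close>
    have Q_scale: "Q (r *\<^sub>R v) v w z = 0" for r v w z
    proof -
      have "Q (r *\<^sub>R v) v w z = r * Q v v w z"
        by (simp add: Q_def curvature_nabla2 B linear_cmul[OF nabla2_linear(1)] linear_cmul[OF nabla2_linear(2)] algebra_simps)
      then show ?thesis
        using Q_anti[of v v w z] by simp
    qed
    show ?thesis
    proof (cases "v = 0")
      case True
      then show ?thesis using Q_anti[of u 0 v u] Q_scale[of 0 u v u] by simp
    next
      case v0: False
      obtain r where "u = r *\<^sub>R v"
      proof (cases "u = v")
        case True
        then show ?thesis using that[of 1] by simp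
      next
        case uv: False
        then have "u \<in> span {v}"
          using False v0 by (auto simp: independent_insert split: if_splits)
        then show ?thesis using that by (auto simp: span_singleton)
      qed
      then show ?thesis
        using Q_scale by simp
    qed
  qed
  have "Q u v w z = 0" for z
  proof (rule curvature_like_eq_0[of Q, OF _ _ Q_anti Q_anti' _ sect])
    show "Q (a + b) v w z = Q a v w z + Q b v w z" for a b v w z
      by (simp add: Q_def curvature_nabla2 B linear_add[OF nabla2_linear(1)] linear_add[OF nabla2_linear(2)] algebra_simps)
    show "Q u v (a + b) z = Q u v a z + Q u v b z" for u v a b z
      by (simp add: Q_def curvature_nabla2 B linear_add[OF nabla2_linear(3)] algebra_simps)
    show "Q u v w z + Q v w u z + Q w u v z = 0" for u v w z
      using arg_cong[OF bianchi[of u v w], of "\<lambda>t. G x t z"] D(2)[of u v] D(2)[of u w] D(2)[of v w]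
      by (simp add: Q_def B algebra_simps)
  qed
  then show ?thesis
    by (intro metric_eqI[OF G x]) (simp add: Q_def B algebra_simps)
qed

end

section \<open>The tension field of an isometric immersion into a space form\<close>

lemma push_has_derivative:
  assumes f: "smooth_on W f" and X: "(X has_derivative X') (at x)" and x: "x \<in> W"
  shows "(push f X has_derivative
    (\<lambda>h. deriv_at (\<lambda>y. deriv_at f y (X x)) x h + deriv_at f x (X' h))) (at x)"
proof -
  have W: "open W" by (rule smooth_onD(1)[OF f])
  \<comment> \<open>The linear field \<open>y \<mapsto> deriv_at f y\<close> is treated as a bilinear one, with a scalar first argument.\<close>
  have "((\<lambda>y. 1 *\<^sub>R deriv_at f y (X y)) has_derivative (\<lambda>h. deriv_at (\<lambda>y. 1 *\<^sub>R deriv_at f y (X x)) x h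
     + 0 *\<^sub>R deriv_at f x (X x) + 1 *\<^sub>R deriv_at f x (X' h))) (at x)"
  proof (rule bilinear_field_has_derivative[of W "\<lambda>y r v. r *\<^sub>R deriv_at f y v" "\<lambda>y. y" x W "\<lambda>h. h" "\<lambda>_. 1" "\<lambda>_. 0" X X'])
    show "bilinear (\<lambda>(r::real) v. r *\<^sub>R deriv_at f q v)" if "q \<in> W" for q
      using linear_frechet_derivative[OF smooth_onD(2)[OF f that]]
      by (auto simp: bilinear_def linear_iff algebra_simps)
    show "(\<lambda>q. u *\<^sub>R deriv_at f q v) differentiable at x" for u v
      using smooth_onD(2)[OF smooth_onD(4)[OF f] x] by (intro derivative_intros) auto
  qed (use W x X in auto)
  then show ?thesis
    by (simp add: push_def[abs_def])
qed

text \<open>From here on \<open>W\<close> is the coordinate image of an open part of the source that carries an orthonormal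
  frame \<open>e\<close>, and \<open>T\<close> is the coordinate image of a chart of the target.\<close>

context
  fixes W :: "'e::euclidean_space set" and G :: "'e metric_field"
    and T :: "'f::euclidean_space set" and H :: "'f metric_field"
    and f :: "'e \<Rightarrow> 'f" and e :: "'e \<Rightarrow> 'e \<Rightarrow> 'e" and K :: real
  assumes G: "riemannian_metric_on W G" and H: "riemannian_metric_on T H"
    and f: "smooth_on W f" and fW: "f ` W \<subseteq> T"
    and iso: "\<And>x u v. x \<in> W \<Longrightarrow> G x u v = H (f x) (deriv_at f x u) (deriv_at f x v)"
    and frame: "orthonormal_frame_on G W e"
begin

private lemma W: "open W"
  by (rule smooth_onD(1)[OF f])

private lemma fx: "x \<in> W \<Longrightarrow> f x \<in> T"
  using fW by blast

private lemma e_smooth: "i \<in> Basis \<Longrightarrow> smooth_on W (e i)"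
  and e_orth: "x \<in> W \<Longrightarrow> i \<in> Basis \<Longrightarrow> j \<in> Basis \<Longrightarrow> G x (e i x) (e j x) = (if i = j then 1 else 0)"
  using frame by (auto simp: orthonormal_frame_on_def)

private lemma push_smooth: "smooth_on W X \<Longrightarrow> smooth_on W (push f X)"
  unfolding push_def[abs_def] by (intro smooth_on_deriv_at f)

private lemma pullback_deriv_smooth:
  assumes "smooth_on W X" "smooth_on W V"
  shows "smooth_on W (pullback_deriv H f X V)"
proof (cases "W = {}")
  \<comment> \<open>The set \<open>T\<close> is known to be open only once it has a point.\<close>
  case True
  then show ?thesis
    using smooth_on_cong[of W "pullback_deriv H f X V" V] assms(2) by blast
next
  case False
  then have "open T"
    using riemannian_metric_onD(4)[OF H] fW by blast
  then show ?thesis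
    unfolding pullback_deriv_def[abs_def] using assms
    by (intro smooth_on_add smooth_on_deriv_at push_smooth
        smooth_on_bilinear_field[OF christoffel_bilinear[OF H] christoffel_smooth[OF H] f fW])
qed

private lemma cov_deriv_smooth:
  assumes "smooth_on W X" "smooth_on W Y"
  shows "smooth_on W (cov_deriv G X Y)"
  unfolding cov_deriv_def[abs_def] using assms W
  by (intro smooth_on_add smooth_on_deriv_at
      smooth_on_bilinear_field[OF christoffel_bilinear[OF G] christoffel_smooth[OF G] smooth_on_ident[OF W]]) auto

private abbreviation "\<tau> \<equiv> tension G H f e"

private lemma tension_smooth: "smooth_on W \<tau>"
  unfolding tension_def[abs_def]
  by (intro smooth_on_sum W smooth_on_diff pullback_deriv_smooth push_smooth cov_deriv_smooth e_smooth)

text \<open>The second fundamental form \<open>(\<nabla>df)(u, v)\<close>.\<close>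

private definition second_form :: "'e \<Rightarrow> 'e \<Rightarrow> 'e \<Rightarrow> 'f"
  where "second_form x u v = deriv_at (\<lambda>y. deriv_at f y v) x u
    + christoffel H (f x) (deriv_at f x u) (deriv_at f x v) - deriv_at f x (christoffel G x u v)"

private lemma second_form_sym: "x \<in> W \<Longrightarrow> second_form x u v = second_form x v u"
  unfolding second_form_def
  using symmetric_second_derivative[OF f] christoffel_torsion_free[OF G] christoffel_torsion_free[OF H fx]
  by metis

text \<open>Differentiating \<open>G(v, w) = H(df v, df w)\<close> and using that both connections are metric and
  torsion-free.\<close>

private lemma second_form_normal:
  assumes x: "x \<in> W"
  shows "H (f x) (second_form x u v) (deriv_at f x w) = 0"
proof -
  note D = riemannian_metric_onD[OF H fx[OF x]]
  note B = bilinear_simps[OF D(1)]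
  define b where "b u v w = H (f x) (second_form x u v) (deriv_at f x w)" for u v w
  have skew: "b u v w + b u w v = 0" for u v w
  proof -
    have d: "(\<lambda>y. deriv_at f y v) differentiable at x" for v
      by (rule smooth_onD(2)[OF smooth_onD(4)[OF f] x])
    have "((\<lambda>y. G y v w) has_derivative (\<lambda>h.
        H (f x) (pullback_deriv H f (\<lambda>_. h) (\<lambda>y. deriv_at f y v) x) (deriv_at f x w)
        + H (f x) (deriv_at f x v) (pullback_deriv H f (\<lambda>_. h) (\<lambda>y. deriv_at f y w) x))) (at x)"
      by (rule has_derivative_transform_within_open[OF
            pullback_deriv_metric[OF H W x fW smooth_onD(2)[OF f x] d d] W x]) (simp add: iso)
    from fun_cong[OF frechet_derivative_at[OF this], of u] show ?thesis
      using christoffel_metric[OF G x, of v w u] D(2)[of "deriv_at f x v"]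
      by (simp add: b_def second_form_def pullback_deriv_def push_def B iso[OF x])
  qed
  have sym: "b u v w = b v u w" for u v w
    unfolding b_def using second_form_sym[OF x] by metis
  \<comment> \<open>A trilinear form symmetric in its first two and skew in its last two arguments vanishes.\<close>
  have "b u v w = 0"
    using skew[of u v w] skew[of w u v] skew[of v w u] sym[of u w v] sym[of w v u] sym[of v u w]
    by linarith
  then show ?thesis by (simp add: b_def)
qed

private lemma tension_second_form:
  assumes x: "x \<in> W"
  shows "\<tau> x = (\<Sum>i\<in>Basis. second_form x (e i x) (e i x))"
  unfolding tension_def
proof (rule sum.cong[OF refl])
  fix i :: 'e assume i: "i \<in> Basis"
  have lin: "linear (deriv_at f x)"
    by (rule linear_frechet_derivative[OF smooth_onD(2)[OF f x]])
  show "pullback_deriv H f (e i) (push f (e i)) x - push f (cov_deriv G (e i) (e i)) x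
      = second_form x (e i x) (e i x)"
    unfolding pullback_deriv_def second_form_def cov_deriv_def
      frechet_derivative_at[OF push_has_derivative[OF f smooth_onD(3)[OF e_smooth[OF i] x] x], symmetric]
    by (simp add: push_def cov_deriv_def linear_add[OF lin])
qed

private lemma tension_normal:
  assumes x: "x \<in> W"
  shows "H (f x) (\<tau> x) (push f X x) = 0" "H (f x) (push f X x) (\<tau> x) = 0"
proof -
  show "H (f x) (\<tau> x) (push f X x) = 0"
    using second_form_normal[OF x]
    by (simp add: tension_second_form[OF x] push_def
        bilinear_simps[OF riemannian_metric_onD(1)[OF H fx[OF x]]])
  then show "H (f x) (push f X x) (\<tau> x) = 0"
    using riemannian_metric_onD(2)[OF H fx[OF x]] by simp
qed

private lemma push_orth:
  "x \<in> W \<Longrightarrow> i \<in> Basis \<Longrightarrow> j \<in> Basis \<Longrightarrow> H (f x) (push f (e i) x) (push f (e j) x) = (if i = j then 1 else 0)"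
  using e_orth by (simp add: push_def iso[symmetric])

text \<open>The divergence of the normal field \<open>\<tau>\<close> along the immersion is \<open>-\<bar>\<tau>\<bar>\<^sup>2\<close>.\<close>

private lemma tension_divergence:
  assumes x: "x \<in> W"
  shows "(\<Sum>i\<in>Basis. H (f x) (pullback_deriv H f (e i) \<tau> x) (push f (e i) x)) = - H (f x) (\<tau> x) (\<tau> x)"
proof -
  note B = bilinear_simps[OF riemannian_metric_onD(1)[OF H fx[OF x]]]
  have "H (f x) (pullback_deriv H f (e i) \<tau> x) (push f (e i) x)
      = - H (f x) (\<tau> x) (pullback_deriv H f (e i) (push f (e i)) x - push f (cov_deriv G (e i) (e i)) x)"
    if i: "i \<in> Basis" for i
  proof -
    let ?d = "\<lambda>h. H (f x) (pullback_deriv H f (\<lambda>_. h) \<tau> x) (push f (e i) x)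
        + H (f x) (\<tau> x) (pullback_deriv H f (\<lambda>_. h) (push f (e i)) x)"
    have "((\<lambda>y. H (f y) (\<tau> y) (push f (e i) y)) has_derivative ?d) (at x)"
      by (rule pullback_deriv_metric[OF H W x fW smooth_onD(2)[OF f x] smooth_onD(2)[OF tension_smooth x]
            smooth_onD(2)[OF push_smooth[OF e_smooth[OF i]] x]])
    then have "((\<lambda>y. 0) has_derivative ?d) (at x)"
      by (rule has_derivative_transform_within_open[OF _ W x]) (simp add: tension_normal)
    then have "?d = (\<lambda>h. 0)"
      by (rule has_derivative_unique) (rule has_derivative_const)
    from fun_cong[OF this, of "e i x"] show ?thesis
      using tension_normal(1)[OF x, of "cov_deriv G (e i) (e i)"]
      by (simp add: B pullback_deriv_def push_def)
  qed
  then show ?thesis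
    by (simp add: sum_negf B(12)[symmetric] tension_def[of G H f e x])
qed

private lemma pullback_deriv_cmul:
  assumes x: "x \<in> W" and V: "\<And>y. y \<in> W \<Longrightarrow> V y = c *\<^sub>R U y" and U: "smooth_on W U"
  shows "pullback_deriv H f X V x = c *\<^sub>R pullback_deriv H f X U x"
proof -
  have "(V has_derivative (\<lambda>h. c *\<^sub>R deriv_at U x h)) (at x)"
    by (rule has_derivative_transform_within_open[OF
          has_derivative_scaleR_right[OF smooth_onD(3)[OF U x]] W x]) (simp add: V)
  from frechet_derivative_at[OF this] show ?thesis
    by (metis (no_types, lifting) V[OF x] bilinear_simps(4)[OF christoffel_bilinear[OF H fx[OF x]]]
        pullback_deriv_def scaleR_add_right)
qed

private lemma rough_laplacian_cmul:
  assumes x: "x \<in> W" and V: "\<And>y. y \<in> W \<Longrightarrow> V y = c *\<^sub>R U y" and U: "smooth_on W U"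
  shows "rough_laplacian G H f e V x = c *\<^sub>R rough_laplacian G H f e U x"
proof -
  have "pullback_deriv H f (e i) (pullback_deriv H f (e i) V) x
      = c *\<^sub>R pullback_deriv H f (e i) (pullback_deriv H f (e i) U) x" if "i \<in> Basis" for i
    by (rule pullback_deriv_cmul[OF x pullback_deriv_cmul[OF _ V U] pullback_deriv_smooth[OF e_smooth[OF that] U]])
  then show ?thesis
    by (simp add: rough_laplacian_def pullback_deriv_cmul[OF x V U] scaleR_sum_right scaleR_diff_right)
qed

context
  assumes curv: "\<And>q u v w. q \<in> T \<Longrightarrow> curvature H q u v w = K *\<^sub>R (H q v w *\<^sub>R u - H q u w *\<^sub>R v)"
begin

private lemma curvature_trace:
  assumes x: "x \<in> W"
  shows "(\<Sum>i\<in>Basis. curvature H (f x) (c *\<^sub>R \<tau> x) (push f (e i) x) (push f (e i) x))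
    = (c * (DIM('e) * K)) *\<^sub>R \<tau> x"
proof -
  have "curvature H (f x) (c *\<^sub>R \<tau> x) (push f (e i) x) (push f (e i) x) = (K * c) *\<^sub>R \<tau> x"
    if "i \<in> Basis" for i
    using that by (simp add: curv[OF fx[OF x]] push_orth[OF x] tension_normal[OF x]
        bilinear_simps[OF riemannian_metric_onD(1)[OF H fx[OF x]]])
  then show ?thesis
    by (simp add: sum_constant_scaleR ac_simps)
qed

text \<open>Biharmonicity makes \<open>\<tau>\<close> an eigensection of the rough Laplacian, with eigenvalue \<open>mK\<close>.\<close>

private lemma rough_laplacian_pow_tension:
  assumes bi: "\<And>y. y \<in> W \<Longrightarrow> bitension G H f e y = 0" and x: "x \<in> W"
  shows "(rough_laplacian G H f e ^^ r) \<tau> x = (DIM('e) * K) ^ r *\<^sub>R \<tau> x"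
  using x
proof (induction r arbitrary: x)
  case (Suc r)
  have "rough_laplacian G H f e \<tau> x = (DIM('e) * K) *\<^sub>R \<tau> x"
    using bi[OF Suc.prems] curvature_trace[OF Suc.prems, of 1] by (simp add: bitension_def)
  then show ?case
    using rough_laplacian_cmul[OF Suc.prems Suc.IH tension_smooth] by (simp add: ac_simps)
qed simp

lemma tau_even_biharmonic:
  assumes bi: "\<And>y. y \<in> W \<Longrightarrow> bitension G H f e y = 0" and x: "x \<in> W" and s: "2 \<le> s"
  shows "tau_even s G H f e x
    = - (real (s - 1) * (2 * K * (DIM('e) * K) ^ (2 * s - 3) * H (f x) (\<tau> x) (\<tau> x))) *\<^sub>R \<tau> x"
proof -
  let ?c = "DIM('e) * K" and ?D = "\<lambda>r. (rough_laplacian G H f e ^^ r) \<tau>"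
  have D: "?D r y = ?c ^ r *\<^sub>R \<tau> y" if "y \<in> W" for r y
    using rough_laplacian_pow_tension[OF bi that] by simp
  note B = bilinear_simps[OF riemannian_metric_onD(1)[OF H fx[OF x]]]
  have nabla: "pullback_deriv H f X (?D r) x = ?c ^ r *\<^sub>R pullback_deriv H f X \<tau> x" for r X
    by (rule pullback_deriv_cmul[OF x D tension_smooth])
  \<comment> \<open>The two leading terms cancel.\<close>
  have "?D (2 * s - 1) x - (\<Sum>j\<in>Basis. curvature H (f x) (?D (2 * s - 2) x) (push f (e j) x) (push f (e j) x)) = 0"
  proof -
    have "2 * s - 1 = Suc (2 * s - 2)" using s by simp
    then show ?thesis
      by (simp only: D[OF x] curvature_trace[OF x]) (simp add: ac_simps)
  qed
  moreover have "(\<Sum>j\<in>Basis.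
        curvature H (f x) (pullback_deriv H f (e j) (?D (s + l - 2)) x) (?D (s - l - 1) x) (push f (e j) x)
      - curvature H (f x) (?D (s + l - 2) x) (pullback_deriv H f (e j) (?D (s - l - 1)) x) (push f (e j) x))
     = (2 * K * ?c ^ (2 * s - 3) * H (f x) (\<tau> x) (\<tau> x)) *\<^sub>R \<tau> x" if l: "l \<in> {1..s - 1}" for l
  proof -
    \<comment> \<open>The truncated subtractions in the exponents are exact because \<open>l \<le> s - 1\<close> and \<open>s \<ge> 2\<close>.\<close>
    have p: "?c ^ (s + l - 2) * ?c ^ (s - l - 1) = ?c ^ (2 * s - 3)"
    proof -
      have "s + l - 2 + (s - l - 1) = 2 * s - 3"
        using l s by auto
      then show ?thesis
        by (metis power_add)
    qed
    have neg: "- (a *\<^sub>R t) - b *\<^sub>R t = - (c *\<^sub>R t)" if "a + b = c" for a b c :: real and t :: 'f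
      using that by (auto simp: scaleR_left_distrib)
    have "curvature H (f x) (pullback_deriv H f (e j) (?D (s + l - 2)) x) (?D (s - l - 1) x) (push f (e j) x)
      - curvature H (f x) (?D (s + l - 2) x) (pullback_deriv H f (e j) (?D (s - l - 1)) x) (push f (e j) x)
      = (- 2 * K * ?c ^ (2 * s - 3) * H (f x) (pullback_deriv H f (e j) \<tau> x) (push f (e j) x)) *\<^sub>R \<tau> x" for j
      unfolding nabla D[OF x] curv[OF fx[OF x]] B tension_normal[OF x] p[symmetric]
      by (simp, rule neg, simp)
    then show ?thesis
      using tension_divergence[OF x]
      by (simp add: sum_negf scaleR_sum_left[symmetric] sum_distrib_left[symmetric])
  qed
  ultimately show ?thesis
    by (simp add: tau_even_def Let_def sum_constant_scaleR)
qed

lemma tension_eq_0: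
  assumes bi: "\<And>y. y \<in> W \<Longrightarrow> bitension G H f e y = 0"
    and even: "tau_even s G H f e x = 0" and x: "x \<in> W" and s: "2 \<le> s" and K: "K \<noteq> 0"
  shows "\<tau> x = 0"
proof (rule ccontr)
  assume "\<tau> x \<noteq> 0"
  moreover from this have "0 < H (f x) (\<tau> x) (\<tau> x)"
    by (rule riemannian_metric_onD(3)[OF H fx[OF x]])
  moreover have "real (s - 1) \<noteq> 0"
    using s by simp
  ultimately have "- (real (s - 1) * (2 * K * (DIM('e) * K) ^ (2 * s - 3) * H (f x) (\<tau> x) (\<tau> x))) \<noteq> 0"
    using K by simp
  then show False
    using even \<open>\<tau> x \<noteq> 0\<close> tau_even_biharmonic[OF bi x s] by (simp only: scaleR_eq_0_iff) simp
qed

end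

end

section \<open>Passing to charts\<close>

lemma riemannian_metric_on_subset:
  assumes "riemannian_metric_on S G" "open W" "W \<subseteq> S"
  shows "riemannian_metric_on W G"
  using assms smooth_on_subset[of S _ W] unfolding riemannian_metric_on_def by blast

theorem theorem3p4:
  fixes M :: "('a::{t2_space,second_countable_topology}, 'e::euclidean_space) riemannian"
    and N :: "('b::{t2_space,second_countable_topology}, 'f::euclidean_space) riemannian"
    and \<phi> :: "'a \<Rightarrow> 'b" and K :: real and s :: nat
  assumes "riemannian_manifold M"
    and "riemannian_manifold N"
    and "has_constant_sectional_curvature N K"
    and "K \<noteq> 0"
    and "isometric_immersion M N \<phi>"
    and "biharmonic M N \<phi>"
    and "s \<ge> 2"
    and "even_harmonic s M N \<phi>"
  shows "harmonic M N \<phi>"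
  unfolding harmonic_def vanishes_def
proof (intro conjI ballI allI impI, goal_cases)
  case 1
  show ?case using assms(5) by (simp add: isometric_immersion_def)
next
  case (2 c d W e x)
  let ?G = "metric M c" and ?H = "metric N d" and ?f = "local_rep c d \<phi>" and ?T = "snd d ` fst d"
  from 2 have W: "open W" "W \<subseteq> overlap c d \<phi>" and e: "orthonormal_frame_on ?G W e" and x: "x \<in> W"
    by auto
  have "overlap c d \<phi> \<subseteq> snd c ` fst c"
    by (auto simp: overlap_def)
  then have G: "riemannian_metric_on W ?G"
    using riemannian_metric_on_subset[OF _ W(1)] W(2) assms(1) 2(1)
    unfolding riemannian_manifold_def by blast
  have H: "riemannian_metric_on ?T ?H"
    using assms(2) 2(2) by (simp add: riemannian_manifold_def)
  have "smooth_on (overlap c d \<phi>) ?f"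
    using assms(5) 2(1,2) unfolding isometric_immersion_def smooth_map_def by blast
  then have f: "smooth_on W ?f"
    by (rule smooth_on_subset[OF _ W])
  have "chart_inv c (snd c p) = p" if "p \<in> fst c" for p
    using assms(1) 2(1) that
    by (auto simp: riemannian_manifold_def smooth_atlas_def is_chart_def homeomorphism_def)
  then have fW: "?f ` W \<subseteq> ?T"
    using W(2) by (fastforce simp: overlap_def local_rep_def)
  have iso: "?G y u v = ?H (?f y) (deriv_at ?f y u) (deriv_at ?f y v)" if "y \<in> W" for y u v
    using assms(5) 2(1,2) W(2) that unfolding isometric_immersion_def by blast
  have curv: "curvature ?H q u v w = K *\<^sub>R (?H q v w *\<^sub>R u - ?H q u w *\<^sub>R v)" if "q \<in> ?T" for q u v w
    using assms(3) 2(2) that unfolding has_constant_sectional_curvature_def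
    by (intro curvature_constant[OF H that]) blast
  have bi: "bitension ?G ?H ?f e y = 0" and even: "tau_even s ?G ?H ?f e y = 0" if "y \<in> W" for y
    using assms(6,8)[unfolded biharmonic_def even_harmonic_def vanishes_def, THEN conjunct2,
        rule_format, OF 2(1-3) that] by simp_all
  show ?case
    by (rule tension_eq_0[OF G H f fW iso e curv bi even[OF x] x assms(7,4)])
qed

end
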